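(* Let $k \geq 92$ be an integer with $k\equiv 0\pmod 4$, and let $f = 1 + \sum_{n=1}^{\infty} a(n) q^{n} \in M_{k}$ with $a(n) \geq 0$ for all positive integers $n \leq k^{2} (\log k + \log \log k)^{2}$. Then $a(n) > 0$ for all $n \geq \frac{1}{7316} k^{4} (\log k + \log \log k)^{2}$.
   Context: $M_k$ is the space of holomorphic modular forms of weight $k$ for $\mathrm{SL}_2(\mathbb{Z})$, with Fourier expansion in $q=e^{2\pi i z}$. *)

theory Defs
  imports "HOL-Complex_Analysis.Complex_Analysis" "HOL-Library.Complex_Order"
begin

definition upper_half_plane :: "complex set" where
  "upper_half_plane = {z. Im z > 0}"

text \<open>Holomorphic modular forms of weight k for SL2(Z): holomorphic on the upper
half plane, invariant under the generators T and S of SL2(Z) (with the weight-k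
automorphy factor), and holomorphic (i.e. bounded) at the cusp.\<close>
definition modular_form :: "nat \<Rightarrow> (complex \<Rightarrow> complex) \<Rightarrow> bool" where
  "modular_form k f \<longleftrightarrow>
     f holomorphic_on upper_half_plane \<and>
     (\<forall>z\<in>upper_half_plane. f (z + 1) = f z) \<and>
     (\<forall>z\<in>upper_half_plane. f (- 1 / z) = z ^ k * f z) \<and>
     (\<exists>B. \<forall>z. Im z \<ge> 1 \<longrightarrow> norm (f z) \<le> B)"

definition q_expansion :: "(complex \<Rightarrow> complex) \<Rightarrow> (nat \<Rightarrow> complex) \<Rightarrow> bool" where
  "q_expansion f a \<longleftrightarrow>
     (\<forall>z\<in>upper_half_plane. (\<lambda>n. a n * exp (2 * pi * \<i> * of_nat n * z)) sums f z)"

end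

theory Submission
  imports Defs
begin

text \<open>Write \<open>f = E + g\<close> with the Eisenstein series \<open>E\<close> of weight \<open>k\<close> (whose coefficients are at least a
  constant times \<open>(2\<pi>)\<^sup>k n\<^bsup>k-1\<^esup> / (k - 1)!\<close>) and a cusp form \<open>g = \<Sum> b(n) q\<^sup>n\<close>.  Hecke's argument gives
  \<open>\<bar>b(n)\<bar> \<le> e\<^sup>\<pi> G n\<^bsup>k/2\<^esup>\<close> with \<open>G = \<Sum> \<bar>b(n)\<bar> e\<^bsup>-\<pi>n\<^esup>\<close>, so everything depends on an upper bound for \<open>G\<close>,
  i.e. for \<open>P = \<Sum>\<^bsub>n \<ge> 1\<^esub> \<bar>a(n)\<bar> e\<^bsup>-\<pi>n\<^esup>\<close>.  If the coefficients are nonnegative, then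
  \<open>1 + P \<le> f(i/Y) = Y\<^sup>k f(iY) \<le> Y\<^sup>k (1 + e\<^bsup>-2\<pi>(Y - 1/2)\<^esup> P)\<close> for \<open>Y \<ge> 2\<close>.  The choice
  \<open>2\<pi>Y = T = k (ln k + ln ln k)\<close> makes the factor in front of \<open>P\<close> small, whence \<open>P\<close> is essentially
  at most \<open>Y\<^sup>k\<close>.  Coefficients that are not known to be nonnegative have index \<open>n > T\<^sup>2\<close>; there
  the negative part of \<open>a(n)\<close> is at most \<open>\<bar>b(n)\<bar>\<close>, and their total contribution to \<open>f(i/Y)\<close> is a tiny
  multiple of \<open>G\<close>.\<close>

subsection \<open>Numerical bounds\<close>

lemma sin_Taylor_5:
  fixes x :: real
  shows "\<bar>sin x - (x - x ^ 3 / 6 + x ^ 5 / 120)\<bar> \<le> \<bar>x\<bar> ^ 6 / 720"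
proof -
  have "(\<Sum>m<6. sin_coeff m * x ^ m) = x - x ^ 3 / 6 + x ^ 5 / 120"
  proof -
    have "{..<6} = {0, 1, 2, 3, 4, 5 :: nat}"
      by auto
    then show ?thesis
      by (simp add: sin_coeff_def fact_numeral)
  qed
  then show ?thesis
    using Maclaurin_sin_bound[of x 6] by (simp add: fact_numeral inverse_eq_divide)
qed

text \<open>The Taylor polynomial gives sin(157/300) <= 1/2 = sin(pi/6), and the sine is increasing
  there. The second decimal matters for the constant in \<open>final_inequality\<close>.\<close>

lemma pi_ge_314: "pi \<ge> 157 / 50"
proof (rule ccontr)
  assume "\<not> ?thesis"
  then have "sin (pi / 6) < sin (157 / 300)"
    using pi_ge_two by (intro sin_monotone_2pi) auto
  also have "\<dots> \<le> 1 / 2"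
    using abs_le_D1[OF sin_Taylor_5[of "157 / 300"]] by (simp add: power_divide)
  finally show False
    by (simp add: sin_30)
qed

text \<open>The same comparison, now at 158/300. It serves to bound zeta(2) = pi^2/6 by 5/3 in
  \<open>has_sum_int_zeta\<close>.\<close>

lemma pi_squared_le: "pi\<^sup>2 \<le> 10"
proof -
  have "pi \<le> 158 / 50"
  proof (rule ccontr)
    assume "\<not> ?thesis"
    then have "sin (158 / 300) < sin (pi / 6)"
      using pi_ge_two by (intro sin_monotone_2pi) auto
    also have "\<dots> = 1 / 2"
      by (simp add: sin_30)
    also have "1 / 2 \<le> sin (158 / 300 :: real)"
      using abs_le_D2[OF sin_Taylor_5[of "158 / 300"]] by (simp add: power_divide)
    finally show False
      by simp
  qed
  then have "pi\<^sup>2 \<le> (158 / 50)\<^sup>2"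
    using pi_ge_zero by (intro power_mono)
  then show ?thesis
    by (simp add: power2_eq_square)
qed

lemma exp_1_ge: "exp (1 :: real) \<ge> 2716 / 1000"
proof -
  have "(\<Sum>n<6. inverse (fact n)) \<le> (\<Sum>n. inverse (fact n) :: real)"
    by (intro sum_le_suminf) (auto intro: summable_exp[of "1::real", simplified])
  also have "\<dots> = exp 1"
    by (simp add: exp_def)
  finally show ?thesis
    by (simp add: eval_nat_numeral)
qed

text \<open>A weak Stirling bound, meant for the factorial in the Eisenstein coefficients. The
  induction step rests on (n/(n+1))^(n+1) <= 1/e, which follows from 1 - t <= exp(-t).\<close>

lemma fact_le_exp:
  assumes "n \<ge> 1"
  shows "fact (n - 1) * exp (real n) \<le> exp 1 * real n ^ n"
  using assms
proof (induction n rule: dec_induct)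
  case (step n)
  have "real n * exp 1 ^ 1 * (fact (n - 1) * exp (real n)) \<le> real n * exp 1 ^ 1 * (exp 1 * real n ^ n)"
    using step by (intro mult_left_mono) auto
  then have "fact n * exp (real (Suc n)) \<le> exp 1 * (exp 1 * real n ^ Suc n)"
    using step(1) by (simp add: fact_reduce exp_add mult_ac add_ac)
  also have "exp 1 * real n ^ Suc n \<le> real (Suc n) ^ Suc n"
  proof -
    have "1 - 1 / real (Suc n) \<le> exp (- (1 / real (Suc n)))"
      using exp_ge_add_one_self[of "- (1 / real (Suc n))"] by simp
    moreover have "1 - 1 / real (Suc n) = real n / real (Suc n)"
      by (simp add: field_simps)
    ultimately have "(real n / real (Suc n)) ^ Suc n \<le> exp (- (1 / real (Suc n))) ^ Suc n"
      by (intro power_mono) auto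
    also have "\<dots> = exp (- 1)"
      unfolding exp_of_nat_mult[symmetric] by simp
    finally show ?thesis
      by (simp add: exp_minus field_simps del: power_Suc of_nat_Suc)
  qed
  finally show ?case
    by simp
qed simp

subsection \<open>Expansions in the nome\<close>

abbreviation nome :: "complex \<Rightarrow> complex" where
  "nome z \<equiv> exp (2 * of_real pi * \<i> * z)"

lemma norm_nome: "norm (nome z) = exp (- (2 * pi * Im z))"
  by (simp add: norm_exp_eq_Re)

lemma norm_nome_less_1: "z \<in> upper_half_plane \<Longrightarrow> norm (nome z) < 1"
  by (simp add: norm_nome upper_half_plane_def)

lemma nome_surj:
  assumes "x \<noteq> 0"
  obtains z where "nome z = x" "norm x = exp (- (2 * pi * Im z))"
proof -
  have "nome (Ln x / (2 * of_real pi * \<i>)) = x"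
    using assms by simp
  with that norm_nome show thesis by metis
qed

lemma q_expansion_iff:
  "q_expansion f a \<longleftrightarrow> (\<forall>z\<in>upper_half_plane. (\<lambda>n. a n * nome z ^ n) sums f z)"
proof -
  have "exp (2 * pi * \<i> * of_nat n * z) = nome z ^ n" for n z
    by (simp add: exp_of_nat_mult [symmetric] mult_ac)
  then show ?thesis
    by (simp add: q_expansion_def)
qed

lemma q_expansion_diff:
  "q_expansion f a \<Longrightarrow> q_expansion g b \<Longrightarrow> q_expansion (\<lambda>z. f z - g z) (\<lambda>n. a n - b n)"
  by (auto simp: q_expansion_iff left_diff_distrib intro: sums_diff)

text \<open>Reflection in the imaginary axis conjugates the nome. Comparing a form with its
  reflection will show that its coefficients are real.\<close>

lemma q_expansion_cnj:
  assumes "q_expansion f a"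
  shows "q_expansion (\<lambda>z. cnj (f (- cnj z))) (\<lambda>n. cnj (a n))"
  unfolding q_expansion_iff
proof
  fix z assume z: "z \<in> upper_half_plane"
  then have "- cnj z \<in> upper_half_plane"
    by (simp add: upper_half_plane_def)
  with assms have "(\<lambda>n. a n * nome (- cnj z) ^ n) sums f (- cnj z)"
    by (auto simp: q_expansion_iff)
  then have "(\<lambda>n. cnj (a n * nome (- cnj z) ^ n)) sums cnj (f (- cnj z))"
    by (simp only: sums_cnj)
  moreover have "cnj (nome (- cnj z)) = nome z"
    by (simp add: exp_cnj)
  ultimately show "(\<lambda>n. cnj (a n) * nome z ^ n) sums cnj (f (- cnj z))"
    by simp
qed

text \<open>Every r in (0, 1) is the nome of a point of the half plane, so pointwise convergence
  there forces radius of convergence at least 1. This opens the way to power series arguments on the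
  unit disc.\<close>

lemma q_expansion_fps:
  assumes "q_expansion f a"
  shows "fps_conv_radius (Abs_fps a) \<ge> 1"
    and "z \<in> upper_half_plane \<Longrightarrow> f z = eval_fps (Abs_fps a) (nome z)"
proof -
  have "summable (\<lambda>n. a n * of_real r ^ n)" if r: "0 < r" "ereal r < 1" for r
  proof -
    obtain z where z: "nome z = of_real r" "norm (complex_of_real r) = exp (- (2 * pi * Im z))"
      using nome_surj[of "of_real r"] r by (metis less_irrefl of_real_eq_0_iff)
    have "exp (- (2 * pi * Im z)) < 1"
      using z r by (auto simp: one_ereal_def)
    then have "z \<in> upper_half_plane"
      by (simp add: upper_half_plane_def zero_less_mult_iff)
    then show ?thesis
      using assms z by (auto simp: q_expansion_iff sums_iff)
  qed
  then show "fps_conv_radius (Abs_fps a) \<ge> 1"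
    unfolding fps_conv_radius_def by (intro conv_radius_geI_ex') simp_all
  show "z \<in> upper_half_plane \<Longrightarrow> f z = eval_fps (Abs_fps a) (nome z)"
    using assms by (auto simp: q_expansion_iff eval_fps_def sums_iff)
qed

text \<open>By the chain rule, d/dz acts on the expansion as 2 pi i q d/dq. Iterating this leads
  from the cotangent to the rows of the Eisenstein series.\<close>

lemma q_expansion_derivative:
  assumes "q_expansion f a"
  obtains D where "q_expansion D (\<lambda>n. 2 * of_real pi * \<i> * of_nat n * a n)"
    and "\<And>z. z \<in> upper_half_plane \<Longrightarrow> (f has_field_derivative D z) (at z)"
proof
  let ?F = "Abs_fps a"
  let ?D = "\<lambda>z. 2 * of_real pi * \<i> * (nome z * eval_fps (fps_deriv ?F) (nome z))"
  have radius: "norm (nome z) < fps_conv_radius ?F" if "z \<in> upper_half_plane" for z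
    using norm_nome_less_1[OF that] q_expansion_fps(1)[OF assms]
    by (metis ereal_less(3) less_le_trans)
  have deriv: "((\<lambda>z. eval_fps ?F (nome z)) has_field_derivative ?D z) (at z)"
    if "z \<in> upper_half_plane" for z
    by (rule derivative_eq_intros has_field_derivative_eval_fps refl radius that | simp add: mult_ac)+
  show "(f has_field_derivative ?D z) (at z)" if "z \<in> upper_half_plane" for z
  proof (rule DERIV_cong_ev[THEN iffD1, OF refl _ refl deriv[OF that]])
    have "open upper_half_plane"
      by (simp add: upper_half_plane_def open_halfspace_Im_gt)
    then show "\<forall>\<^sub>F w in nhds z. eval_fps ?F (nome w) = f w"
      using that q_expansion_fps(2)[OF assms]
      by (auto elim!: eventually_mono dest: eventually_nhds_in_open)
  qed
  show "q_expansion ?D (\<lambda>n. 2 * of_real pi * \<i> * of_nat n * a n)"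
    unfolding q_expansion_iff
  proof
    fix z assume z: "z \<in> upper_half_plane"
    have "norm (nome z) < fps_conv_radius (fps_X * fps_deriv ?F)"
      using radius[OF z] fps_conv_radius_deriv[of ?F]
        fps_conv_radius_mult[of fps_X "fps_deriv ?F"] by (auto simp: min_def split: if_splits)
    then have "(\<lambda>n. fps_nth (fps_X * fps_deriv ?F) n * nome z ^ n)
        sums eval_fps (fps_X * fps_deriv ?F) (nome z)"
      by (rule sums_eval_fps)
    moreover have "fps_nth (fps_X * fps_deriv ?F) n = of_nat n * a n" for n
      by (cases n) auto
    moreover have "eval_fps (fps_X * fps_deriv ?F) (nome z) = nome z * eval_fps (fps_deriv ?F) (nome z)"
      using radius[OF z] fps_conv_radius_deriv[of ?F] by (subst eval_fps_mult) (auto intro: less_le_trans)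
    ultimately have "(\<lambda>n. of_nat n * a n * nome z ^ n) sums (nome z * eval_fps (fps_deriv ?F) (nome z))"
      by simp
    from sums_mult[OF this, of "2 * of_real pi * \<i>"]
    show "(\<lambda>n. 2 * of_real pi * \<i> * of_nat n * a n * nome z ^ n) sums ?D z"
      by (simp add: mult_ac)
  qed
qed

section \<open>Cauchy bound and reduction to height 1/2\<close>

text \<open>The line Im z = y maps onto the circle of radius exp(-2 pi y) in the nome; this is
  Cauchy's inequality on that circle.\<close>

lemma coefficient_bound:
  assumes f: "q_expansion f a" and y: "y > 0" and B: "\<And>z. Im z = y \<Longrightarrow> norm (f z) \<le> B"
  shows "norm (a n) \<le> B * exp (2 * pi * y) ^ n"
proof -
  let ?F = "Abs_fps a" and ?r = "exp (- (2 * pi * y))"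
  have r: "?r < 1"
    using y by simp
  have ball: "cball (0::complex) ?r \<subseteq> eball 0 (fps_conv_radius ?F)"
  proof
    fix x :: complex assume "x \<in> cball 0 ?r"
    then have "norm x < 1"
      using r by (auto intro: le_less_trans)
    then have "ereal (norm x) < fps_conv_radius ?F"
      using q_expansion_fps(1)[OF f] by (metis ereal_less(3) less_le_trans)
    then show "x \<in> eball 0 (fps_conv_radius ?F)"
      by (simp add: in_eball_iff)
  qed
  have "norm ((deriv ^^ n) (eval_fps ?F) 0) \<le> fact n * B / ?r ^ n"
  proof (rule Cauchy_inequality)
    show "eval_fps ?F holomorphic_on ball 0 ?r"
      using ball ball_subset_cball by (intro holomorphic_on_eval_fps) blast
    show "continuous_on (cball 0 ?r) (eval_fps ?F)"
      by (rule continuous_on_subset[OF continuous_on_eval_fps ball])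
    fix x :: complex assume x: "norm (0 - x) = ?r"
    then have "x \<noteq> 0"
      by auto
    then obtain z where z: "nome z = x" "norm x = exp (- (2 * pi * Im z))"
      by (rule nome_surj)
    with x have "Im z = y"
      by simp
    then show "norm (eval_fps ?F x) \<le> B"
      using B[OF \<open>Im z = y\<close>] q_expansion_fps(2)[OF f, of z] z(1) y \<open>Im z = y\<close>
      by (simp add: upper_half_plane_def)
  qed auto
  moreover have "eval_fps ?F has_fps_expansion ?F"
  proof (rule eval_fps_has_fps_expansion)
    show "fps_conv_radius ?F > 0"
      by (rule less_le_trans[OF _ q_expansion_fps(1)[OF f]]) simp
  qed
  then have "(deriv ^^ n) (eval_fps ?F) 0 = fact n * a n"
    by (auto dest!: fps_nth_fps_expansion[where n = n] simp: field_simps)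
  ultimately have "fact n * norm (a n) \<le> fact n * (B / ?r ^ n)"
    by (simp add: norm_mult)
  then have "norm (a n) \<le> B / ?r ^ n"
    by (rule mult_left_le_imp_le) simp
  then show ?thesis
    by (simp add: exp_minus field_simps power_inverse)
qed

text \<open>The points of small imaginary part are pushed up by \<open>z \<mapsto> -1/z\<close>: if \<open>\<bar>Re z\<bar> \<le> 1/2\<close> and
  \<open>Im z < 1/2\<close>, then \<open>\<bar>z\<bar>\<^sup>2 < 1/2\<close>, so the imaginary part at least doubles.\<close>

lemma invariant_bound:
  fixes h :: "complex \<Rightarrow> real"
  assumes T: "\<And>z. z \<in> upper_half_plane \<Longrightarrow> h (z + 1) = h z"
    and S: "\<And>z. z \<in> upper_half_plane \<Longrightarrow> h (- 1 / z) = h z"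
    and B: "\<And>z. Im z \<ge> 1 / 2 \<Longrightarrow> h z \<le> B"
    and z: "z \<in> upper_half_plane"
  shows "h z \<le> B"
proof -
  have T_nat: "h (z + of_nat n) = h z" if "z \<in> upper_half_plane" for z n
  proof (induction n)
    case (Suc n)
    have "z + of_nat n \<in> upper_half_plane"
      using that by (simp add: upper_half_plane_def)
    from T[OF this] Suc show ?case
      by (simp add: add_ac)
  qed simp
  have T_int: "h (z - of_int n) = h z" if z: "z \<in> upper_half_plane" for z n
  proof (cases "n \<ge> 0")
    case True
    then show ?thesis
      using T_nat[of "z - of_int n" "nat n"] z by (simp add: upper_half_plane_def)
  next
    case False
    then show ?thesis
      using T_nat[of z "nat (- n)"] z by simp
  qed
  \<comment> \<open>Induction on \<open>n\<close>, which bounds the number of doublings needed to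
    lift the point to height 1/2.\<close>
  have "h z \<le> B" if "z \<in> upper_half_plane" "Im z * 2 ^ n \<ge> 1 / 2" for n z
    using that
  proof (induction n arbitrary: z)
    case 0
    then show ?case
      using B by simp
  next
    case (Suc n)
    show ?case
    proof (cases "Im z \<ge> 1 / 2")
      case True
      then show ?thesis by (rule B)
    next
      case False
      define w where "w = z - of_int (round (Re z))"
      have w: "\<bar>Re w\<bar> \<le> 1 / 2" "Im w = Im z"
        using of_int_round_abs_le[of "Re z"] by (simp_all add: w_def abs_minus_commute)
      have "Im w > 0"
        using Suc.prems w by (simp add: upper_half_plane_def)
      have "(Re w)\<^sup>2 \<le> (1 / 2)\<^sup>2" "(Im w)\<^sup>2 \<le> (1 / 2)\<^sup>2"
        using w False \<open>Im w > 0\<close> power_mono[of "\<bar>Re w\<bar>" "1/2" 2] by (auto intro!: power_mono)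
      then have le: "(Re w)\<^sup>2 + (Im w)\<^sup>2 \<le> 1 / 2"
        by (simp add: power2_eq_square)
      have pos: "(Re w)\<^sup>2 + (Im w)\<^sup>2 > 0"
        using \<open>Im w > 0\<close> by (simp add: add_nonneg_pos)
      have Im: "Im (- 1 / w) = Im w / ((Re w)\<^sup>2 + (Im w)\<^sup>2)"
        by (simp add: Im_divide)
      then have "Im (- 1 / w) \<ge> 2 * Im w"
        using mult_left_mono[OF le, of "2 * Im w"] pos \<open>Im w > 0\<close>
        unfolding Im by (simp add: pos_le_divide_eq)
      then have "Im (- 1 / w) * 2 ^ n \<ge> (2 * Im w) * 2 ^ n"
        by (intro mult_right_mono) auto
      with Suc.prems(2) w have "Im (- 1 / w) * 2 ^ n \<ge> 1 / 2"
        by (simp add: mult_ac)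
      moreover have "- 1 / w \<in> upper_half_plane"
        using Im pos \<open>Im w > 0\<close> by (simp add: upper_half_plane_def)
      ultimately have "h (- 1 / w) \<le> B"
        by (rule Suc.IH[rotated])
      then show ?thesis
        using S[of w] T_int[OF Suc.prems(1)] \<open>Im w > 0\<close>
        by (simp add: w_def upper_half_plane_def)
    qed
  qed
  moreover obtain n where "1 / 2 / Im z < 2 ^ n"
    using real_arch_pow[of 2] by auto
  then have "Im z * 2 ^ n \<ge> 1 / 2"
    using z by (simp add: field_simps upper_half_plane_def)
  ultimately show ?thesis
    using z by blast
qed

subsection \<open>Coefficients of cusp forms\<close>

text \<open>The constant term is left out so that the sum decays like exp(-2 pi y) in the height y.
  At y = 1/2 it is the quantity called P or G in the overview.\<close>

definition abs_series :: "(nat \<Rightarrow> complex) \<Rightarrow> real \<Rightarrow> real" where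
  "abs_series a y = (\<Sum>n. norm (a (Suc n)) * exp (- (2 * pi * y)) ^ Suc n)"

lemma summable_abs_series:
  assumes "q_expansion f a" "y > 0"
  shows "summable (\<lambda>n. norm (a n) * exp (- (2 * pi * y)) ^ n)"
proof -
  let ?x = "complex_of_real (exp (- (2 * pi * y)))"
  have "norm ?x < 1"
    using assms by simp
  then have "ereal (norm ?x) < conv_radius a"
    using q_expansion_fps(1)[OF assms(1)]
    by (metis ereal_less(3) less_le_trans fps_conv_radius_def fps_nth_Abs_fps ext)
  from abs_summable_in_conv_radius[OF this] show ?thesis
    by (simp add: norm_mult norm_power)
qed

lemma summable_abs_series_Suc:
  assumes "q_expansion f a" "y > 0"
  shows "summable (\<lambda>n. norm (a (Suc n)) * exp (- (2 * pi * y)) ^ Suc n)"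
  using summable_abs_series[OF assms] by (subst summable_Suc_iff)

lemma abs_series_nonneg: "abs_series a y \<ge> 0" if "q_expansion f a" "y > 0"
  unfolding abs_series_def by (intro suminf_nonneg summable_abs_series_Suc[OF that]) simp

text \<open>All exponents are at least 1, so raising the height from x to y gains at least one
  factor exp(-2 pi (y - x)) in every term.\<close>

lemma abs_series_mono:
  assumes "q_expansion f a" "0 < x" "x \<le> y"
  shows "abs_series a y \<le> exp (- (2 * pi * (y - x))) * abs_series a x"
proof -
  let ?d = "exp (- (2 * pi * (y - x)))"
  have le: "norm (a (Suc n)) * exp (- (2 * pi * y)) ^ Suc n
      \<le> ?d * (norm (a (Suc n)) * exp (- (2 * pi * x)) ^ Suc n)" for n
  proof -
    have "exp (- (2 * pi * y)) = ?d * exp (- (2 * pi * x))"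
      by (simp add: field_simps flip: exp_add)
    then have "exp (- (2 * pi * y)) ^ Suc n = ?d ^ Suc n * exp (- (2 * pi * x)) ^ Suc n"
      by (simp only: power_mult_distrib)
    also have "\<dots> \<le> ?d * exp (- (2 * pi * x)) ^ Suc n"
    proof (rule mult_right_mono)
      have "?d \<le> 1"
        using assms by simp
      then show "?d ^ Suc n \<le> ?d"
        using power_decreasing[of 1 "Suc n" ?d] by simp
    qed simp
    finally show ?thesis
      by (simp add: mult_left_mono mult.left_commute del: power_Suc)
  qed
  have "y > 0"
    using assms by simp
  then have "abs_series a y \<le> (\<Sum>n. ?d * (norm (a (Suc n)) * exp (- (2 * pi * x)) ^ Suc n))"
    unfolding abs_series_def
    by (intro suminf_le le summable_mult summable_abs_series_Suc[OF assms(1)] assms(2))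
  also have "\<dots> = ?d * abs_series a x"
    unfolding abs_series_def
    by (rule suminf_mult) (rule summable_abs_series_Suc[OF assms(1,2)])
  finally show ?thesis .
qed

lemma norm_minus_const_le:
  assumes "q_expansion f a" "z \<in> upper_half_plane"
  shows "norm (f z - a 0) \<le> abs_series a (Im z)"
proof -
  have "(\<lambda>n. a (Suc n) * nome z ^ Suc n) sums (f z - a 0)"
    using assms by (subst sums_Suc_iff) (auto simp: q_expansion_iff)
  moreover have "norm (a (Suc n) * nome z ^ Suc n)
      = norm (a (Suc n)) * exp (- (2 * pi * Im z)) ^ Suc n" for n
    unfolding norm_mult norm_power norm_nome ..
  ultimately show ?thesis
    unfolding abs_series_def
    using summable_abs_series_Suc[OF assms(1), of "Im z"] assms(2)
      summable_norm[of "\<lambda>n. a (Suc n) * nome z ^ Suc n"]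
    by (simp only: upper_half_plane_def mem_Collect_eq sums_iff)
qed

text \<open>The function u^m exp(-c u) is largest at u = m/c; the proof is t <= exp(t - 1) with t =
  c u / m, raised to the power m.\<close>

lemma power_le_exp:
  fixes c u :: real
  assumes "u \<ge> 0" "c > 0" "m > 0"
  shows "u ^ m \<le> (real m / c) ^ m * exp (c * u - real m)"
proof -
  have "c * u / m \<le> exp (c * u / m - 1)"
    using exp_ge_add_one_self[of "c * u / m - 1"] by simp
  then have "(c * u / m) ^ m \<le> exp (c * u / m - 1) ^ m"
    using assms by (intro power_mono) auto
  also have "\<dots> = exp (c * u - m)"
    using assms by (simp add: field_simps flip: exp_of_nat_mult)
  finally have "(real m / c) ^ m * (c * u / m) ^ m \<le> (real m / c) ^ m * exp (c * u - m)"
    using assms by (intro mult_left_mono) auto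
  moreover have "(real m / c) ^ m * (c * u / m) ^ m = u ^ m"
    using assms by (simp flip: power_mult_distrib)
  ultimately show ?thesis
    by simp
qed

text \<open>Hecke's argument with an explicit constant. The function |g(z)| (Im z)^(k/2) is
  invariant under both generators, so its values at height at least 1/2 bound it everywhere. At
  those heights \<open>abs_series_mono\<close> gives the decay of g and \<open>power_le_exp\<close>
  absorbs the power.\<close>

lemma cusp_coefficient_bound:
  assumes g: "q_expansion g b" and "b 0 = 0" and k: "even k" "k > 0"
    and S: "\<And>z. z \<in> upper_half_plane \<Longrightarrow> g (- 1 / z) = z ^ k * g z"
  shows "norm (b n) \<le> exp pi * abs_series b (1 / 2) * real n ^ (k div 2)"
\<comment> \<open>The height chosen below has n in its denominator, hence the separate case.\<close>
proof (cases "n = 0")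
  case True
  then show ?thesis
    using assms(2) abs_series_nonneg[OF g, of "1/2"] by simp
next
  case False
  define m where "m = k div 2"
  have m: "m > 0" "k = 2 * m"
    using k by (auto simp: m_def elim!: evenE)
  define G where "G = abs_series b (1 / 2)"
  have G: "G \<ge> 0"
    unfolding G_def by (rule abs_series_nonneg[OF g]) simp
  define h where "h = (\<lambda>z. norm (g z) * Im z ^ m)"
  define c where "c = (m / (2 * pi)) ^ m"
  have c: "c > 0"
    using m by (simp add: c_def)
  define B where "B = exp pi * G * (c * exp (- real m))"
  have h: "h z \<le> B" if "z \<in> upper_half_plane" for z
  proof (rule invariant_bound[OF _ _ _ that])
    show "h (z + 1) = h z" if "z \<in> upper_half_plane" for z
    proof -
      have "z + 1 \<in> upper_half_plane" "nome (z + 1) = nome z"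
        using that by (simp_all add: upper_half_plane_def ring_distribs exp_add)
      then show ?thesis
        using q_expansion_fps(2)[OF g] that by (simp add: h_def)
    qed
    show "h (- 1 / z) = h z" if z: "z \<in> upper_half_plane" for z
    proof -
      have "z \<noteq> 0"
        using z by (auto simp: upper_half_plane_def)
      moreover have "Im (- 1 / z) = Im z / (norm z)\<^sup>2"
        by (simp add: Im_divide cmod_power2)
      ultimately show ?thesis
        unfolding h_def S[OF z] by (simp add: norm_mult norm_power power_divide m(2) flip: power_mult)
    qed
    fix z :: complex assume y: "Im z \<ge> 1 / 2"
    have "norm (g z) \<le> exp (- (2 * pi * (Im z - 1 / 2))) * G"
      using norm_minus_const_le[OF g, of z] abs_series_mono[OF g _ y] y \<open>b 0 = 0\<close>
      by (simp add: upper_half_plane_def G_def)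
    moreover have "Im z ^ m \<le> c * exp (2 * pi * Im z - m)"
      using power_le_exp[of "Im z" "2 * pi" m] m(1) y by (simp add: c_def)
    ultimately have "h z \<le> (exp (- (2 * pi * (Im z - 1 / 2))) * G) * (c * exp (2 * pi * Im z - m))"
      unfolding h_def using G y by (intro mult_mono) auto
    also have "\<dots> = (exp (- (2 * pi * (Im z - 1 / 2))) * exp (2 * pi * Im z - m)) * G * c"
      by (simp only: mult_ac)
    also have "exp (- (2 * pi * (Im z - 1 / 2))) * exp (2 * pi * Im z - m) = exp pi * exp (- real m)"
      unfolding mult_exp_exp by (rule arg_cong[of _ _ exp]) (simp add: field_simps)
    also have "exp pi * exp (- real m) * G * c = B"
      by (simp add: B_def)
    finally show "h z \<le> B" .
  qed
  \<comment> \<open>This height minimises y^(-m) exp(2 pi n y). The resulting factors exp(m) and 1/c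
    cancel those in \<open>B\<close>.\<close>
  define y where "y = m / (2 * pi * n)"
  have y: "y > 0"
    using m False by (simp add: y_def)
  have "norm (g z) \<le> B / y ^ m" if "Im z = y" for z
    using h[of z] that y by (simp add: h_def upper_half_plane_def field_simps)
  from coefficient_bound[OF g y this]
  have "norm (b n) \<le> B / y ^ m * exp (2 * pi * y) ^ n" .
  also have "exp (2 * pi * y) ^ n = exp m"
    using False by (simp add: y_def flip: exp_of_nat_mult)
  also have "y ^ m = c / real n ^ m"
    by (simp add: y_def c_def power_divide power_mult_distrib)
  also have "B / (c / real n ^ m) * exp m = exp pi * G * real n ^ m"
    using c by (simp add: B_def exp_minus)
  finally show ?thesis
    by (simp add: G_def m_def)
qed

subsection \<open>The Eisenstein series\<close>

lemma upper_half_plane_not_Int: "z \<in> upper_half_plane \<Longrightarrow> z \<notin> \<int>"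
  by (auto simp: upper_half_plane_def elim!: Ints_cases)

text \<open>The reflection formula Gamma(z) Gamma(1 - z) = pi / sin(pi z) is differentiated on both
  sides, and the common nonzero factor is cancelled.\<close>

lemma Digamma_reflection:
  fixes z :: complex
  assumes "z \<notin> \<int>"
  shows "Digamma (1 - z) - Digamma z = of_real pi * cos (of_real pi * z) / sin (of_real pi * z)"
proof -
  have sin: "sin (of_real pi * z) \<noteq> 0"
    using assms by (auto simp: sin_eq_0 elim!: Ints_cases)
  have "1 - z \<notin> \<int>"
    using assms by (metis Ints_1 Ints_diff diff_diff_eq2 add_diff_cancel_left')
  with assms have z: "z \<notin> \<int>\<^sub>\<le>\<^sub>0" "1 - z \<notin> \<int>\<^sub>\<le>\<^sub>0"
    using nonpos_Ints_Int by blast+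
  have "((\<lambda>z. Gamma z * Gamma (1 - z)) has_field_derivative
      Gamma z * Digamma z * Gamma (1 - z) - Gamma z * (Gamma (1 - z) * Digamma (1 - z))) (at z)"
    using z by (auto intro!: derivative_eq_intros simp: mult_ac)
  moreover have "((\<lambda>z. Gamma z * Gamma (1 - z)) has_field_derivative
      - (of_real pi * (cos (of_real pi * z) * of_real pi)) / (sin (of_real pi * z))\<^sup>2) (at z)"
    unfolding Gamma_reflection_complex using sin
    by (auto intro!: derivative_eq_intros simp: power2_eq_square)
  ultimately have "Gamma z * Digamma z * Gamma (1 - z) - Gamma z * (Gamma (1 - z) * Digamma (1 - z))
      = - (of_real pi * (cos (of_real pi * z) * of_real pi)) / (sin (of_real pi * z))\<^sup>2"
    by (rule DERIV_unique)
  then have "(Gamma z * Gamma (1 - z)) * (Digamma (1 - z) - Digamma z)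
      = of_real pi * (cos (of_real pi * z) * of_real pi) / (sin (of_real pi * z))\<^sup>2"
    by (simp add: algebra_simps)
  then have "of_real pi / sin (of_real pi * z) * (Digamma (1 - z) - Digamma z)
      = of_real pi / sin (of_real pi * z) * (of_real pi * cos (of_real pi * z) / sin (of_real pi * z))"
    unfolding Gamma_reflection_complex by (simp add: power2_eq_square)
  moreover have "complex_of_real pi / sin (of_real pi * z) \<noteq> 0"
    using sin by simp
  ultimately show ?thesis
    by (metis mult_left_cancel)
qed

lemma Digamma_reflection_nome:
  assumes z: "z \<in> upper_half_plane"
  shows "Digamma (1 - z) - Digamma z = - of_real pi * \<i> * (1 + nome z) / (1 - nome z)"
proof -
  \<comment> \<open>A square root of the nome, in which sine and cosine become rational
    functions.\<close>
  define x where "x = exp (\<i> * (of_real pi * z))"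
  have x: "x \<noteq> 0" "nome z = x\<^sup>2"
    by (simp_all add: x_def mult_ac flip: exp_of_nat_mult)
  have x1: "x\<^sup>2 \<noteq> 1"
    using norm_nome_less_1[OF z] by (auto simp: x(2))
  have "exp (- (\<i> * (of_real pi * z))) = inverse x"
    by (simp add: x_def exp_minus)
  then have cs: "cos (of_real pi * z) = (x + inverse x) / 2" "sin (of_real pi * z) = (x - inverse x) / (2 * \<i>)"
    by (simp_all add: cos_exp_eq sin_exp_eq x_def)
  have "of_real pi * cos (of_real pi * z) / sin (of_real pi * z)
      = of_real pi * (\<i> * (x\<^sup>2 + 1) / (x\<^sup>2 - 1))"
    unfolding cs using x x1 by (simp add: divide_simps power2_eq_square)
  also have "\<i> * (x\<^sup>2 + 1) / (x\<^sup>2 - 1) = - (\<i> * (1 + x\<^sup>2) / (1 - x\<^sup>2))"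
    using x1 by (simp add: divide_simps) (simp add: algebra_simps)
  finally show ?thesis
    unfolding x(2) using Digamma_reflection[OF upper_half_plane_not_Int[OF z]] by (simp add: mult.assoc)
qed

text \<open>The base case is the geometric series for (1 + q) / (1 - q) = 1 + 2 (q + q^2 + ...),
  which explains the halved constant term; each further n is one differentiation. The constant term
  dies after the first derivative, and (-1)^n comes from the inner function 1 - z.\<close>

lemma Polygamma_reflection_q_expansion:
  "q_expansion (\<lambda>z. (-1) ^ n * Polygamma n (1 - z) - Polygamma n z)
     (\<lambda>m. (2 * of_real pi * \<i> * of_nat m) ^ n * (if m = 0 then - of_real pi * \<i> else - 2 * of_real pi * \<i>))"
proof (induction n)
  case 0
  show ?case
    unfolding q_expansion_iff
  proof
    fix z assume z: "z \<in> upper_half_plane"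
    have "(\<lambda>m. - 2 * of_real pi * \<i> * nome z ^ m) sums (- 2 * of_real pi * \<i> * (1 / (1 - nome z)))"
      by (intro sums_mult geometric_sums norm_nome_less_1 z)
    moreover have "(\<lambda>m. if m = 0 then of_real pi * \<i> else 0) sums (of_real pi * \<i>)"
      by (rule sums_single)
    ultimately have "(\<lambda>m. - 2 * of_real pi * \<i> * nome z ^ m + (if m = 0 then of_real pi * \<i> else 0))
        sums (- 2 * of_real pi * \<i> * (1 / (1 - nome z)) + of_real pi * \<i>)"
      by (rule sums_add)
    moreover have "nome z \<noteq> 1"
      using norm_nome_less_1[OF z] by (metis norm_one less_irrefl)
    then have "- 2 * of_real pi * \<i> * (1 / (1 - nome z)) + of_real pi * \<i> = Digamma (1 - z) - Digamma z"
      unfolding Digamma_reflection_nome[OF z] by (simp add: divide_simps) (simp add: algebra_simps)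
    moreover have eq: "(\<lambda>m. (2 * of_real pi * \<i> * of_nat m) ^ 0
        * (if m = 0 then - of_real pi * \<i> else - 2 * of_real pi * \<i>) * nome z ^ m)
      = (\<lambda>m. - 2 * of_real pi * \<i> * nome z ^ m + (if m = 0 then of_real pi * \<i> else 0))"
      by (rule ext) auto
    ultimately show "(\<lambda>m. (2 * of_real pi * \<i> * of_nat m) ^ 0
        * (if m = 0 then - of_real pi * \<i> else - 2 * of_real pi * \<i>) * nome z ^ m)
        sums ((-1) ^ 0 * Digamma (1 - z) - Digamma z)"
      unfolding eq unfolding power_0 mult_1 by metis
  qed
next
  case (Suc n)
  obtain D where D: "q_expansion D (\<lambda>m. 2 * of_real pi * \<i> * of_nat m * ((2 * of_real pi * \<i> * of_nat m) ^ n
        * (if m = 0 then - of_real pi * \<i> else - 2 * of_real pi * \<i>)))"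
    and deriv: "\<And>z. z \<in> upper_half_plane \<Longrightarrow>
      ((\<lambda>z. (-1) ^ n * Polygamma n (1 - z) - Polygamma n z) has_field_derivative D z) (at z)"
    using q_expansion_derivative[OF Suc.IH] by blast
  have "D z = (-1) ^ Suc n * Polygamma (Suc n) (1 - z) - Polygamma (Suc n) z"
    if z: "z \<in> upper_half_plane" for z
  proof (rule DERIV_unique[OF deriv[OF z]])
    have "1 - z \<notin> \<int>"
      using z by (auto simp: upper_half_plane_def elim!: Ints_cases simp: complex_eq_iff)
    then have "z \<notin> \<int>\<^sub>\<le>\<^sub>0" "1 - z \<notin> \<int>\<^sub>\<le>\<^sub>0"
      using upper_half_plane_not_Int[OF z] nonpos_Ints_Int by blast+
    then show "((\<lambda>z. (-1) ^ n * Polygamma n (1 - z) - Polygamma n z) has_field_derivative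
        (-1) ^ Suc n * Polygamma (Suc n) (1 - z) - Polygamma (Suc n) z) (at z)"
      by (auto intro!: derivative_eq_intros)
  qed
  with D show ?case
    by (auto simp: q_expansion_iff mult.assoc)
qed

text \<open>The two series run over d >= 0 and d <= -1, so that 0 is counted once. Unconditional
  summability is assumed, which lets ordinary series evaluate both halves.\<close>

lemma has_sum_int_halves:
  fixes f :: "int \<Rightarrow> 'a :: banach"
  assumes f: "f summable_on UNIV" and a: "(\<lambda>n. f (int n)) sums a" and b: "(\<lambda>n. f (- int n - 1)) sums b"
  shows "(f has_sum (a + b)) UNIV"
proof -
  have bij1: "bij_betw int UNIV {0..}"
    by (rule bij_betwI[of _ _ _ nat]) auto
  have bij2: "bij_betw (\<lambda>n. - int n - 1) UNIV {..<0}"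
    by (rule bij_betwI[of _ _ _ "\<lambda>m. nat (- m - 1)"]) auto
  obtain a' where a': "(f has_sum a') {0..}"
    using summable_on_subset_banach[OF f] by (auto simp: summable_on_def)
  then have "a' = a"
    using has_sum_imp_sums[of "\<lambda>n. f (int n)" a'] a
    by (simp add: has_sum_reindex_bij_betw[OF bij1] sums_unique2)
  obtain b' where b': "(f has_sum b') {..<0}"
    using summable_on_subset_banach[OF f] by (auto simp: summable_on_def)
  then have "b' = b"
    using has_sum_imp_sums[of "\<lambda>n. f (- int n - 1)" b'] b
    by (simp add: has_sum_reindex_bij_betw[OF bij2] sums_unique2)
  have "(f has_sum (a' + b')) ({0..} \<union> {..<0})"
    by (rule has_sum_Un_disjoint[OF a' b']) auto
  also have "{0..} \<union> {..<0::int} = UNIV"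
    by auto
  finally show ?thesis
    using \<open>a' = a\<close> \<open>b' = b\<close> by simp
qed

text \<open>With n = k - 1 odd, the terms with d >= 0 form Polygamma n at w and those with d < 0
  form Polygamma n at 1 - w, each up to the factor n!; the sign in the second half disappears
  because k is even. The cotangent expansion then applies.\<close>

lemma lipschitz_formula:
  assumes w: "w \<in> upper_half_plane" and k: "even k" "k \<ge> 2"
    and summable: "(\<lambda>d::int. inverse ((w + of_int d) ^ k)) summable_on UNIV"
  shows "(\<lambda>m. (2 * of_real pi * \<i>) ^ k / fact (k - 1) * (of_nat m ^ (k - 1) * nome w ^ m))
    sums (\<Sum>\<^sub>\<infinity>d. inverse ((w + of_int d :: complex) ^ k))"
proof -
  obtain n where n: "k = Suc n" "n > 0" "odd n"
    using k by (cases k) auto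
  define a where "a = (\<Sum>j. inverse ((w + of_nat j) ^ k))"
  define b where "b = (\<Sum>j. inverse ((1 - w + of_nat j) ^ k))"
  have "w \<noteq> 0" "1 - w \<noteq> 0"
    using w by (auto simp: upper_half_plane_def)
  then have "summable (\<lambda>j. inverse ((w + of_nat j) ^ k))" "summable (\<lambda>j. inverse ((1 - w + of_nat j) ^ k))"
    using k by (auto intro!: Polygamma_converges')
  then have "(\<lambda>j. inverse ((w + of_int (int j)) ^ k)) sums a"
    and b: "(\<lambda>j. inverse ((1 - w + of_nat j) ^ k)) sums b"
    by (simp_all add: a_def b_def summable_sums)
  moreover have "(w + of_int (- int j - 1)) ^ k = (1 - w + of_nat j) ^ k" for j
  proof -
    have "w + of_int (- int j - 1) = - (1 - w + of_nat j)"
      by simp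
    then show ?thesis
      by (simp only: power_minus_even[OF k(1)])
  qed
  ultimately have sum: "(\<Sum>\<^sub>\<infinity>d. inverse ((w + of_int d :: complex) ^ k)) = a + b"
    by (intro infsumI has_sum_int_halves summable) simp_all
  have "(\<lambda>m. (2 * of_real pi * \<i> * of_nat m) ^ n * (if m = 0 then - of_real pi * \<i> else - 2 * of_real pi * \<i>) * nome w ^ m)
      sums ((-1) ^ n * Polygamma n (1 - w) - Polygamma n w)"
    using Polygamma_reflection_q_expansion[of n] w by (auto simp: q_expansion_iff)
  also have "(-1) ^ n * Polygamma n (1 - w) - Polygamma n w = - fact n * (a + b)"
    using n by (simp add: Polygamma_def a_def b_def ring_distribs)
  finally have "(\<lambda>m. (- 1 / fact n) * ((2 * of_real pi * \<i> * of_nat m) ^ n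
        * (if m = 0 then - of_real pi * \<i> else - 2 * of_real pi * \<i>) * nome w ^ m))
      sums ((- 1 / fact n) * (- fact n * (a + b)))"
    by (rule sums_mult)
  also have "(- 1 / fact n) * (- fact n * (a + b)) = a + b"
    by simp
  \<comment> \<open>The two minus signs cancel and one more factor 2 pi i completes the power k. The
    term m = 0 vanishes on both sides since n > 0.\<close>
  also have "(\<lambda>m. (- 1 / fact n) * ((2 * of_real pi * \<i> * of_nat m) ^ n
        * (if m = 0 then - of_real pi * \<i> else - 2 * of_real pi * \<i>) * nome w ^ m))
      = (\<lambda>m. (2 * of_real pi * \<i>) ^ k / fact (k - 1) * (of_nat m ^ (k - 1) * nome w ^ m))"
    using n by (intro ext) (auto simp: power_mult_distrib)
  finally show ?thesis
    by (simp add: sum)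
qed

section \<open>Absolute convergence and inversion of the lattice sum\<close>

lemma summable_on_int_inverse_squares: "(\<lambda>d::int. 1 / (1 + (real_of_int d)\<^sup>2)) summable_on UNIV"
proof -
  have "summable (\<lambda>n. inverse (real n ^ 2))"
    by (rule inverse_power_summable) simp
  then have *: "summable (\<lambda>n. 1 / (1 + (real n)\<^sup>2))"
    by (rule summable_comparison_test'[where N = 1])
      (auto simp: inverse_eq_divide intro!: divide_left_mono mult_pos_pos add_pos_nonneg)
  have "(\<lambda>n. 1 / (1 + (real n)\<^sup>2)) summable_on UNIV"
    by (rule summable_nonneg_imp_summable_on[OF *]) simp
  moreover have "bij_betw nat {0..} UNIV"
    by (rule bij_betwI[of _ _ _ int]) auto
  moreover have "bij_betw (\<lambda>m. nat (- m)) {..<0} {1..}"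
    by (rule bij_betwI[of _ _ _ "\<lambda>n. - int n"]) auto
  ultimately have "(\<lambda>d. 1 / (1 + (real (nat d))\<^sup>2)) summable_on {0..}"
    and "(\<lambda>d. 1 / (1 + (real (nat (- d)))\<^sup>2)) summable_on {..<0}"
    using summable_on_reindex_bij_betw[of nat "{0..}" UNIV "\<lambda>n. 1 / (1 + (real n)\<^sup>2)"]
      summable_on_reindex_bij_betw[of "\<lambda>m. nat (- m)" "{..<0}" "{1..}" "\<lambda>n. 1 / (1 + (real n)\<^sup>2)"]
    by (auto intro: summable_on_subset)
  then have "(\<lambda>d::int. 1 / (1 + (real_of_int d)\<^sup>2)) summable_on {0..}"
    and "(\<lambda>d::int. 1 / (1 + (real_of_int d)\<^sup>2)) summable_on {..<0}"
    by (auto elim!: summable_on_cong[THEN iffD1, rotated])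
  then have "(\<lambda>d::int. 1 / (1 + (real_of_int d)\<^sup>2)) summable_on ({0..} \<union> {..<0})"
    by (rule summable_on_Un_disjoint) auto
  moreover have "{0..} \<union> {..<0::int} = UNIV"
    by auto
  ultimately show ?thesis
    by simp
qed

text \<open>With r = |c z + d|, the imaginary part gives |c| <= r / Im z, and the triangle
  inequality then bounds |d|, so max(|c|, |d|) <= r K. For k >= 4 this yields the summable product
  majorant 1 / ((1 + c^2) (1 + d^2)) up to a constant.\<close>

lemma eisenstein_abs_summable:
  assumes z: "z \<in> upper_half_plane" and k: "k \<ge> 4"
  shows "(\<lambda>x::int \<times> int. norm (case x of (c, d) \<Rightarrow> inverse ((of_int c * z + of_int d) ^ k))) summable_on UNIV"
proof -
  define u where "u = (\<lambda>d::int. 1 / (1 + (real_of_int d)\<^sup>2))"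
  define K where "K = (1 + norm z) / Im z + 1"
  have y: "Im z > 0"
    using z by (simp add: upper_half_plane_def)
  have K: "K > 0"
    using y by (simp add: K_def add_nonneg_pos)
  have le: "norm (inverse ((of_int c * z + of_int d) ^ k)) \<le> 4 * K ^ k * (u c * u d)" for c d :: int
  proof (cases "c = 0 \<and> d = 0")
    \<comment> \<open>The origin stays in the index set: inverse 0 = 0 makes its term
      vanish.\<close>
    case True
    then show ?thesis
      using k K by (simp add: u_def power_0_left)
  next
    case False
    define r where "r = norm (of_int c * z + of_int d)"
    define t where "t = max \<bar>real_of_int c\<bar> \<bar>real_of_int d\<bar>"
    have t: "t \<ge> 1"
      using False by (auto simp: t_def max_def simp flip: of_int_abs)
    have "\<bar>real_of_int c\<bar> * Im z \<le> r"
      using abs_Im_le_cmod[of "of_int c * z + of_int d"] y by (simp add: r_def abs_mult)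
    then have c: "\<bar>real_of_int c\<bar> \<le> r / Im z"
      using y by (simp add: field_simps)
    have "\<bar>real_of_int d\<bar> = norm ((of_int c * z + of_int d) - of_int c * z)"
      by simp
    also have "\<dots> \<le> r + \<bar>real_of_int c\<bar> * norm z"
      unfolding r_def by (rule order_trans[OF norm_triangle_ineq4]) (simp add: norm_mult)
    also have "\<dots> \<le> r + r / Im z * norm z"
      using c by (intro add_left_mono mult_right_mono) auto
    finally have d: "\<bar>real_of_int d\<bar> \<le> r + r / Im z * norm z" .
    have r: "r \<ge> 0"
      by (simp add: r_def)
    have "t \<le> r / Im z + r / Im z * norm z + r"
      using c d r y unfolding t_def by (intro max.boundedI) (auto intro: order_trans add_increasing)
    also have "\<dots> = r * K"
      by (simp add: K_def ring_distribs add_divide_distrib)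
    finally have rK: "t \<le> r * K" .
    then have "r > 0"
      using t r K by (cases "r = 0") auto
    have uu: "1 + (real_of_int c)\<^sup>2 \<le> 2 * t\<^sup>2" "1 + (real_of_int d)\<^sup>2 \<le> 2 * t\<^sup>2"
    proof -
      have "\<bar>real_of_int c\<bar>\<^sup>2 \<le> t\<^sup>2" "\<bar>real_of_int d\<bar>\<^sup>2 \<le> t\<^sup>2" "1\<^sup>2 \<le> t\<^sup>2"
        using t by (intro power_mono; simp add: t_def)+
      then show "1 + (real_of_int c)\<^sup>2 \<le> 2 * t\<^sup>2" "1 + (real_of_int d)\<^sup>2 \<le> 2 * t\<^sup>2"
        by simp_all
    qed
    have "(1 + (real_of_int c)\<^sup>2) * (1 + (real_of_int d)\<^sup>2) \<le> (2 * t\<^sup>2) * (2 * t\<^sup>2)"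
      using uu by (intro mult_mono) auto
    also have "\<dots> = 4 * t ^ 4"
      by (simp add: power2_eq_square power4_eq_xxxx)
    also have "\<dots> \<le> 4 * t ^ k"
      using t k by (intro mult_left_mono power_increasing) auto
    also have "\<dots> \<le> 4 * (r * K) ^ k"
      using t rK by (intro mult_left_mono power_mono) auto
    finally have main: "(1 + (real_of_int c)\<^sup>2) * (1 + (real_of_int d)\<^sup>2) \<le> 4 * K ^ k * r ^ k"
      by (simp add: power_mult_distrib mult_ac)
    have pos: "(1 + (real_of_int c)\<^sup>2) * (1 + (real_of_int d)\<^sup>2) > 0"
      by (intro mult_pos_pos add_pos_nonneg) auto
    have "1 / r ^ k \<le> 4 * K ^ k / ((1 + (real_of_int c)\<^sup>2) * (1 + (real_of_int d)\<^sup>2))"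
      using main pos \<open>r > 0\<close> by (subst frac_le_eq) (simp_all add: field_simps divide_le_0_iff)
    then show ?thesis
      by (simp add: u_def r_def norm_inverse norm_power divide_inverse)
  qed
  have "u summable_on UNIV"
    unfolding u_def by (rule summable_on_int_inverse_squares)
  then have "((\<lambda>d. u c * u d) has_sum (u c * infsum u UNIV)) UNIV" for c
    by (intro has_sum_cmult_right has_sum_infsum)
  moreover have "(\<lambda>c. u c * infsum u UNIV) summable_on UNIV"
    using \<open>u summable_on UNIV\<close> by (rule summable_on_cmult_left)
  ultimately have "(\<lambda>(c, d). u c * u d) summable_on (SIGMA c:UNIV. UNIV)"
    by (intro summable_on_SigmaI) (auto simp: u_def)
  then have "(\<lambda>x. 4 * K ^ k * (case x of (c, d) \<Rightarrow> u c * u d)) summable_on UNIV"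
    by (intro summable_on_cmult_right) simp
  then show ?thesis
    by (rule Infinite_Sum.abs_summable_on_comparison_test') (use le in \<open>auto simp: case_prod_unfold\<close>)
qed

text \<open>Since c (-1/z) + d = (d z - c) / z, inversion only permutes the lattice by (c, d) -> (d,
  -c) and pulls out z^k.\<close>

lemma eisenstein_sum_inversion:
  fixes z :: complex
  assumes "z \<noteq> 0" "even k" "k > 0"
  shows "(\<Sum>\<^sub>\<infinity>(c::int, d::int). inverse ((of_int c * (- 1 / z) + of_int d) ^ k))
    = z ^ k * (\<Sum>\<^sub>\<infinity>(c::int, d::int). inverse ((of_int c * z + of_int d) ^ k))"
proof -
  let ?f = "\<lambda>(c::int, d::int). inverse ((of_int c * z + of_int d) ^ k)"
  have bij: "bij_betw (\<lambda>(c::int, d::int). (d, - c)) UNIV UNIV"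
    by (rule bij_betwI[of _ _ _ "\<lambda>(c, d). (- d, c)"]) auto
  have "inverse ((of_int c * (- 1 / z) + of_int d) ^ k) = z ^ k * ?f (d, - c)" for c d :: int
  proof -
    have "of_int c * (- 1 / z) + of_int d = (of_int d * z + of_int (- c)) / z"
      using assms by (simp add: field_simps)
    then show ?thesis
      using assms by (simp only: power_divide prod.case) (simp add: divide_inverse mult.commute)
  qed
  then have "(\<Sum>\<^sub>\<infinity>(c::int, d::int). inverse ((of_int c * (- 1 / z) + of_int d) ^ k))
      = (\<Sum>\<^sub>\<infinity>x. z ^ k * ?f (case x of (c, d) \<Rightarrow> (d, - c)))"
    by (intro infsum_cong) (auto simp: case_prod_unfold)
  also have "\<dots> = z ^ k * (\<Sum>\<^sub>\<infinity>x. ?f (case x of (c, d) \<Rightarrow> (d, - c)))"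
    by (rule infsum_cmult_right')
  also have "(\<Sum>\<^sub>\<infinity>x. ?f (case x of (c, d) \<Rightarrow> (d, - c))) = (\<Sum>\<^sub>\<infinity>x. ?f x)"
    by (rule infsum_reindex_bij_betw[OF bij])
  finally show ?thesis .
qed

text \<open>The row c = 1 of the absolutely convergent lattice sum supplies the summability that
  \<open>lipschitz_formula\<close> asks for.\<close>

lemma lipschitz_q_expansion:
  assumes k: "even k" "k \<ge> 4"
  shows "q_expansion (\<lambda>w. \<Sum>\<^sub>\<infinity>d::int. inverse ((w + of_int d) ^ k))
    (\<lambda>m. (2 * of_real pi * \<i>) ^ k / fact (k - 1) * of_nat m ^ (k - 1))"
  unfolding q_expansion_iff
proof
  fix w assume w: "w \<in> upper_half_plane"
  have "(\<lambda>x. case x of (c::int, d::int) \<Rightarrow> inverse ((of_int c * w + of_int d) ^ k)) summable_on UNIV \<times> UNIV"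
    using eisenstein_abs_summable[OF w k(2)] unfolding UNIV_Times_UNIV
      by (rule Infinite_Sum.abs_summable_summable)
  from summable_on_SigmaD1[OF this, of 1]
  have "(\<lambda>d::int. inverse ((w + of_int d) ^ k)) summable_on UNIV"
    by simp
  from lipschitz_formula[OF w _ _ this] k
  show "(\<lambda>m. (2 * of_real pi * \<i>) ^ k / fact (k - 1) * of_nat m ^ (k - 1) * nome w ^ m)
      sums (\<Sum>\<^sub>\<infinity>d::int. inverse ((w + of_int d) ^ k))"
    by (simp only: mult.assoc)
qed

text \<open>Here Z = 2 zeta(k), because inverse 0 = 0 removes d = 0. The first term gives zeta(k) >=
  1, and zeta(k) <= zeta(2) <= 5/3.\<close>

lemma has_sum_int_zeta:
  assumes k: "even k" "k \<ge> 2"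
  obtains Z where "((\<lambda>d::int. inverse ((of_int d :: complex) ^ k)) has_sum of_real Z) UNIV" "2 \<le> Z" "Z \<le> 10 / 3"
proof -
  define f where "f = (\<lambda>d::int. inverse (real_of_int d ^ k))"
  have "f d \<le> 2 * (1 / (1 + (real_of_int d)\<^sup>2))" for d
  proof (cases "d = 0")
    case False
    then have "\<bar>real_of_int d\<bar> \<ge> 1"
      by linarith
    then have "\<bar>real_of_int d\<bar> ^ 2 \<le> \<bar>real_of_int d\<bar> ^ k" "1 \<le> \<bar>real_of_int d\<bar> ^ 2"
      by (rule power_increasing[OF k(2)]) (rule one_le_power[OF \<open>\<bar>real_of_int d\<bar> \<ge> 1\<close>])
    then have "1 + (real_of_int d)\<^sup>2 \<le> 2 * real_of_int d ^ k"
      using k by (simp add: power_even_abs)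
    moreover have "0 < 1 + (real_of_int d)\<^sup>2"
      by (simp add: add_pos_nonneg)
    ultimately show ?thesis
      unfolding f_def by (simp add: field_simps)
  qed (use k in \<open>simp add: f_def power_0_left\<close>)
  moreover have "f d \<ge> 0" for d
    using k by (simp add: f_def zero_le_even_power)
  ultimately have "f summable_on UNIV"
    by (intro summable_on_comparison_test[OF summable_on_cmult_right[OF summable_on_int_inverse_squares, of 2]]) auto
  define b where "b = (\<Sum>n. inverse (real (Suc n) ^ k))"
  have "summable (\<lambda>n. inverse (real n ^ k))"
    using inverse_power_summable[OF k(2)] by simp
  then have summable: "summable (\<lambda>n. inverse (real (Suc n) ^ k))"
    by (subst summable_Suc_iff)
  then have b: "(\<lambda>n. inverse (real (Suc n) ^ k)) sums b"
    unfolding b_def by (rule summable_sums)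
  then have "(\<lambda>n. inverse (real n ^ k)) sums (b + inverse (real 0 ^ k))"
    by (rule sums_Suc)
  then have "(\<lambda>n. f (int n)) sums b"
    using k by (simp add: f_def power_0_left)
  moreover have "f (- int n - 1) = inverse (real (Suc n) ^ k)" for n
  proof -
    have "real_of_int (- int n - 1) = - real (Suc n)"
      by simp
    then show ?thesis
      unfolding f_def by (simp only: power_minus_even[OF k(1)])
  qed
  then have "(\<lambda>n. f (- int n - 1)) sums b"
    using b by simp
  ultimately have "(f has_sum (b + b)) UNIV"
    using \<open>f summable_on UNIV\<close> by (intro has_sum_int_halves)
  then have "((\<lambda>d. complex_of_real (f d)) has_sum of_real (b + b)) UNIV"
    by (rule has_sum_of_real)
  moreover have "b \<ge> 1"
    using sum_le_suminf[OF summable, of "{0}"] by (simp add: b_def)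
  moreover have "b \<le> pi\<^sup>2 / 6"
    unfolding b_def sums_unique[OF inverse_squares_sums]
  proof (rule suminf_le[OF _ summable sums_summable[OF inverse_squares_sums]])
    fix n
    have "(1 + real n)\<^sup>2 \<le> (1 + real n) ^ k"
      using k by (intro power_increasing) auto
    then show "inverse (real (Suc n) ^ k) \<le> 1 / real ((n + 1)\<^sup>2)"
      unfolding of_nat_Suc of_nat_power of_nat_add of_nat_1 inverse_eq_divide add.commute[of "real n" 1]
      by (intro divide_left_mono mult_pos_pos zero_less_power) auto
  qed
  then have "b \<le> 5 / 3"
    using pi_squared_le by simp
  ultimately show thesis
    by (intro that[of "b + b"]) (simp_all add: f_def)
qed

section \<open>Fourier expansion of the Eisenstein series\<close>

text \<open>The double series of p(m) q^(c m) is regrouped by the product n = c m, which produces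
  divisor sums.\<close>

lemma lambert_series:
  assumes f: "q_expansion f (\<lambda>m. p m)" and p: "p 0 = 0" and z: "z \<in> upper_half_plane"
    and b: "((\<lambda>c. f (of_nat c * z)) has_sum b) {1..}"
  shows "((\<lambda>n. (\<Sum>m | m dvd n. p m) * nome z ^ n) has_sum b) {1..}"
proof -
  define r where "r = norm (nome z)"
  have r: "0 < r" "r < 1"
    using norm_nome_less_1[OF z] by (simp_all add: r_def)
  have im: "Im z > 0"
    using z by (simp add: upper_half_plane_def)
  define t where "t = (\<lambda>(c, m). p m * nome z ^ (c * m))"
  have row: "((\<lambda>m. t (c, m)) has_sum f (of_nat c * z)) {1..}" if "c \<in> {1..}" for c
  proof -
    have c: "of_nat c * z \<in> upper_half_plane"
      using that z by (simp add: upper_half_plane_def)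
    have nome: "nome (of_nat c * z) = nome z ^ c"
      by (simp add: mult_ac flip: exp_of_nat_mult)
    have "summable (\<lambda>m. norm (p m * nome (of_nat c * z) ^ m))"
      using summable_abs_series[OF f, of "Im (of_nat c * z)"] c
      by (simp add: norm_mult norm_power norm_nome upper_half_plane_def)
    moreover have "(\<lambda>m. p m * nome (of_nat c * z) ^ m) sums f (of_nat c * z)"
      using f c by (auto simp: q_expansion_iff)
    ultimately have "((\<lambda>m. p m * nome (of_nat c * z) ^ m) has_sum f (of_nat c * z)) UNIV"
      by (rule norm_summable_imp_has_sum)
    then have "((\<lambda>m. t (c, m)) has_sum f (of_nat c * z)) UNIV"
      by (simp add: t_def nome power_mult)
    then show ?thesis
      by (rule has_sum_cong_neutral[THEN iffD1, rotated -1]) (use p in \<open>auto simp: t_def not_le\<close>)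
  qed
  have "t summable_on (SIGMA c:{1..}. {1..})"
  proof (rule Infinite_Sum.abs_summable_summable)
    \<comment> \<open>For c, m >= 1 one has c m >= c + (m - 1), so a term is at most r^c times
      \<open>u m\<close>, a product of summable factors.\<close>
    define u where "u = (\<lambda>m. norm (p m) * r ^ (m - 1))"
    have "summable (\<lambda>m. norm (p m) * r ^ m)"
      using summable_abs_series[OF f im] by (simp add: r_def norm_nome)
    then have "summable (\<lambda>m. (norm (p m) * r ^ m) * (1 / r))"
      by (rule summable_mult2)
    moreover have eq: "(norm (p m) * r ^ m) * (1 / r) = u m" for m
      using p r by (cases m) (simp_all add: u_def)
    ultimately have "summable u"
      by (simp only: eq)
    then have u: "u summable_on {1..}"
      using summable_nonneg_imp_summable_on[of u] summable_on_subset[of u UNIV "{1..}"] r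
      by (simp add: u_def)
    have geometric: "(\<lambda>c. r ^ c) summable_on {1..}"
      using summable_nonneg_imp_summable_on[of "\<lambda>c. r ^ c"] summable_on_subset[of "\<lambda>c. r ^ c" UNIV "{1..}"] r
      by (simp add: summable_geometric)
    have "((\<lambda>m. r ^ c * u m) has_sum (r ^ c * infsum u {1..})) {1..}" for c
      using u by (intro has_sum_cmult_right has_sum_infsum)
    moreover have "(\<lambda>c. r ^ c * infsum u {1..}) summable_on {1..}"
      using geometric by (rule summable_on_cmult_left)
    ultimately have "(\<lambda>(c, m). r ^ c * u m) summable_on (SIGMA c:{1..}. {1..})"
      using r by (intro summable_on_SigmaI) (auto simp: u_def)
    then show "(\<lambda>x. norm (t x)) summable_on (SIGMA c:{1..}. {1..})"
    proof (rule Infinite_Sum.abs_summable_on_comparison_test')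
      fix x :: "nat \<times> nat" assume "x \<in> (SIGMA c:{1..}. {1..})"
      then obtain c m where x: "x = (c, Suc m)" "c \<ge> 1"
        by (metis One_nat_def Suc_pred atLeast_iff mem_Sigma_iff not_one_le_zero prod.collapse gr0I)
      then have "c + m \<le> c * Suc m"
        by simp
      then have "r ^ (c * Suc m) \<le> r ^ (c + m)"
        using r by (intro power_decreasing) auto
      then have "norm (p (Suc m)) * r ^ (c * Suc m) \<le> norm (p (Suc m)) * r ^ (c + m)"
        by (rule mult_left_mono) simp
      also have "norm (p (Suc m)) * r ^ (c * Suc m) = norm (t x)"
        unfolding x t_def prod.case norm_mult norm_power r_def ..
      also have "norm (p (Suc m)) * r ^ (c + m) = (case x of (c, m) \<Rightarrow> r ^ c * u m)"
        by (simp add: x u_def power_add)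
      finally show "norm (t x) \<le> (case x of (c, m) \<Rightarrow> r ^ c * u m)" .
    qed
  qed
  with row b have t: "(t has_sum b) (SIGMA c:{1..}. {1..})"
    by (rule has_sum_SigmaI)
  \<comment> \<open>A divisor m of n corresponds to the factorisation n = (n/m) m.\<close>
  have bij: "bij_betw (\<lambda>(n, m). (n div m, m)) (SIGMA n:{1..}. {m. m dvd n}) (SIGMA c:{1::nat..}. {1::nat..})"
    by (rule bij_betwI[of _ _ _ "\<lambda>(c, m). (c * m, m)"]) (auto simp: Suc_le_eq div_greater_zero_iff dest: dvd_imp_le intro: Nat.gr0I)
  have "((\<lambda>x. t (case x of (n, m) \<Rightarrow> (n div m, m))) has_sum b) (SIGMA n:{1..}. {m. m dvd n})"
    using has_sum_reindex_bij_betw[OF bij, of t b] t by simp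
  then have "((\<lambda>(n, m). p m * nome z ^ n) has_sum b) (SIGMA n:{1..}. {m. m dvd n})"
    by (rule has_sum_cong[THEN iffD1, rotated]) (auto simp: t_def)
  moreover have "((\<lambda>m. (\<lambda>(n, m). p m * nome z ^ n) (n, m)) has_sum ((\<Sum>m | m dvd n. p m) * nome z ^ n)) {m. m dvd n}"
    if "n \<in> {1..}" for n
    using that by (intro has_sum_finiteI) (auto simp: sum_distrib_right)
  ultimately show ?thesis
    by (rule has_sum_SigmaD)
qed

text \<open>E is the lattice sum divided by its row c = 0, which is Z = 2 zeta(k), so that the
  constant term is 1. Because 4 divides k, the factor (2 pi i)^k is positive.\<close>

lemma eisenstein_series_exists:
  assumes k: "k mod 4 = 0" "k \<ge> 4"
  obtains E e where "q_expansion E (\<lambda>n. of_real (e n))"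
    and "\<And>z. z \<in> upper_half_plane \<Longrightarrow> E (- 1 / z) = z ^ k * E z"
    and "e 0 = 1"
    and "\<And>n. n \<ge> 1 \<Longrightarrow> e n \<ge> 3 / 5 * ((2 * pi) ^ k / fact (k - 1)) * real n ^ (k - 1)"
proof -
  have even: "even k"
    using k by presburger
  obtain Z where Z: "((\<lambda>d::int. inverse ((of_int d :: complex) ^ k)) has_sum of_real Z) UNIV" "2 \<le> Z" "Z \<le> 10 / 3"
    using has_sum_int_zeta[OF even] k by auto
  define R where "R = (\<lambda>w. \<Sum>\<^sub>\<infinity>d::int. inverse ((w + of_int d :: complex) ^ k))"
  define F where "F = (\<lambda>z. \<lambda>(c::int, d::int). inverse ((of_int c * z + of_int d :: complex) ^ k))"
  define C where "C = (2 * pi) ^ k / fact (k - 1)"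
  define e where "e = (\<lambda>n. if n = 0 then 1 else 2 * C / Z * (\<Sum>m | m dvd n. real m ^ (k - 1)))"
  define E where "E = (\<lambda>z. (\<Sum>\<^sub>\<infinity>x. F z x) / of_real Z)"
  have "\<i> ^ k = 1"
  proof -
    obtain j where "k = 4 * j"
      using k(1) by blast
    then have "\<i> ^ k = (\<i> ^ 4) ^ j"
      by (simp only: power_mult)
    then show ?thesis
      by (simp add: power4_eq_xxxx)
  qed
  then have C: "(2 * of_real pi * \<i>) ^ k / fact (k - 1) = complex_of_real C"
    by (simp add: C_def power_mult_distrib)
  define p where "p = (\<lambda>m. complex_of_real C * of_nat m ^ (k - 1))"
  have R: "q_expansion R p"
    using lipschitz_q_expansion[OF even k(2)] unfolding C R_def p_def .
  have "q_expansion E (\<lambda>n. of_real (e n))"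
    unfolding q_expansion_iff
  proof
    fix z assume z: "z \<in> upper_half_plane"
    have F: "F z summable_on (SIGMA c:UNIV. UNIV)"
      using eisenstein_abs_summable[OF z k(2)] unfolding F_def UNIV_Times_UNIV
      by (rule Infinite_Sum.abs_summable_summable)
    have row: "((\<lambda>d. F z (c, d)) has_sum R (of_int c * z)) UNIV" for c
    proof -
      have "(\<lambda>(c, d). F z (c, d)) summable_on (SIGMA c:UNIV. UNIV)"
        using F by simp
      then have "(\<lambda>d. F z (c, d)) summable_on UNIV"
        by (rule summable_on_SigmaD1) simp
      then show ?thesis
        by (simp add: R_def F_def)
    qed
    have "(F z has_sum (\<Sum>\<^sub>\<infinity>x. F z x)) (SIGMA c:UNIV. UNIV)"
      using F by simp
    from has_sum_SigmaD[OF this row]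
    have rows: "((\<lambda>c. R (of_int c * z)) has_sum (\<Sum>\<^sub>\<infinity>x. F z x)) UNIV" .
    \<comment> \<open>Substituting d -> -d identifies the rows c and -c, so the total is row 0 plus
      twice the sum over c >= 1.\<close>
    have row_uminus: "R (of_int (- c) * z) = R (of_int c * z)" for c
    proof -
      have bij: "bij_betw uminus (UNIV :: int set) UNIV"
        by (rule bij_betwI[of _ _ _ uminus]) auto
      have "(of_int (- c) * z + of_int (- d)) ^ k = (of_int c * z + of_int d) ^ k" for d
        using power_minus_even[OF even, of "of_int c * z + of_int d"] by simp
      then show ?thesis
        unfolding R_def
        using infsum_reindex_bij_betw[OF bij, of "\<lambda>d. inverse ((of_int (- c) * z + of_int d) ^ k)"]
        by simp
    qed
    obtain b where b: "((\<lambda>c. R (of_int c * z)) has_sum b) {1..}"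
      using has_sum_imp_summable[OF rows] summable_on_subset_banach
      by (metis subset_UNIV summable_on_def)
    have "bij_betw uminus {..<0} {1::int..}"
      by (rule bij_betwI[of _ _ _ uminus]) auto
    from has_sum_reindex_bij_betw[OF this, of "\<lambda>c. R (of_int c * z)" b] b
    have "((\<lambda>c. R (of_int c * z)) has_sum b) {..<0}"
      by (simp only: row_uminus)
    from has_sum_Un_disjoint[OF this b]
    have "((\<lambda>c. R (of_int c * z)) has_sum (b + b)) ({..<0} \<union> {1..})"
      by fastforce
    moreover have "R (of_int 0 * z) = of_real Z"
      using infsumI[OF Z(1)] by (simp add: R_def)
    ultimately have "((\<lambda>c. R (of_int c * z)) has_sum (of_real Z + (b + b))) (insert 0 ({..<0} \<union> {1..}))"
      using has_sum_insert[of 0 "{..<0} \<union> {1..}" "\<lambda>c. R (of_int c * z)" "b + b"] by simp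
    moreover have "insert 0 ({..<0} \<union> {1..}) = (UNIV :: int set)"
      by auto
    ultimately have total: "(\<Sum>\<^sub>\<infinity>x. F z x) = of_real Z + 2 * b"
      using has_sum_unique[OF rows] by simp
    have "bij_betw int {1..} {1..}"
      by (rule bij_betwI[of _ _ _ nat]) auto
    from has_sum_reindex_bij_betw[OF this, of "\<lambda>c. R (of_int c * z)" b] b
    have "((\<lambda>c. R (of_nat c * z)) has_sum b) {1..}"
      by simp
    from lambert_series[OF R _ z this] k
    have "((\<lambda>n. (\<Sum>m | m dvd n. p m) * nome z ^ n) has_sum b) {1..}"
      by (simp add: p_def)
    from has_sum_cmult_right[OF this, of "of_real (2 / Z)"]
    have "((\<lambda>n. of_real (e n) * nome z ^ n) has_sum (of_real (2 / Z) * b)) {1..}"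
      by (rule has_sum_cong[THEN iffD1, rotated])
        (auto simp: e_def p_def sum_distrib_left sum_distrib_right sum_divide_distrib mult_ac)
    then have "((\<lambda>n. of_real (e n) * nome z ^ n) has_sum (1 + of_real (2 / Z) * b)) (insert 0 {1..})"
      using has_sum_insert[of 0 "{1..}" "\<lambda>n. of_real (e n) * nome z ^ n" "of_real (2 / Z) * b"]
      by (simp add: e_def)
    moreover have "insert 0 {1..} = (UNIV :: nat set)"
      by auto
    moreover have "E z = 1 + of_real (2 / Z) * b"
      using Z by (simp add: E_def total add_divide_distrib)
    ultimately show "(\<lambda>n. of_real (e n) * nome z ^ n) sums E z"
      using has_sum_imp_sums by metis
  qed
  moreover have "E (- 1 / z) = z ^ k * E z" if "z \<in> upper_half_plane" for z
  proof -
    have "z \<noteq> 0"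
      using that by (auto simp: upper_half_plane_def)
    then show ?thesis
      using eisenstein_sum_inversion[of z k] even k unfolding E_def F_def by simp
  qed
  moreover have "e n \<ge> 3 / 5 * C * real n ^ (k - 1)" if "n \<ge> 1" for n
  proof -
    have "C > 0"
      by (simp add: C_def)
    then have "3 / 5 * C \<le> 2 * C / Z"
      using Z by (simp add: field_simps)
    moreover have "real n ^ (k - 1) \<le> (\<Sum>m | m dvd n. real m ^ (k - 1))"
      using that by (intro member_le_sum) auto
    ultimately have "3 / 5 * C * real n ^ (k - 1) \<le> 2 * C / Z * (\<Sum>m | m dvd n. real m ^ (k - 1))"
      using \<open>C > 0\<close> Z(2) by (intro mult_mono) simp_all
    then show ?thesis
      using that by (simp add: e_def)
  qed
  ultimately show thesis
    using that[of E e] by (simp add: C_def e_def)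
qed

subsection \<open>Estimates for large weight\<close>

text \<open>The half weight m is the exponent in the Hecke bound. By construction exp L = k ln k,
  T^2 is the end of the range where nonnegativity is assumed, and 2 pi Y = T.\<close>

locale large_weight =
  fixes k m :: nat and L T Y :: real
  assumes k: "k = 2 * m" "m \<ge> 46"
  defines "L \<equiv> ln (real k) + ln (ln (real k))"
    and "T \<equiv> real k * L"
    and "Y \<equiv> T / (2 * pi)"
begin

lemma ln_k_ge_1: "ln (real k) \<ge> 1"
proof -
  have "exp 1 \<le> real k"
    using exp_le k by simp
  then show ?thesis
    using k by (subst ln_ge_iff) auto
qed

text \<open>The bound by m/6 uses tangent lines of the concave function ln at 92 and at 5, the
  latter being near ln 92, together with 92 <= e^5 and 5 <= e^2. It makes the threshold polynomial
  in m in \<open>final_inequality\<close>.\<close>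

lemma L_bounds: "ln (real k) \<le> L" "L \<le> 2 * ln (real k)" "1 \<le> L" "L \<le> real m / 6"
proof -
  have lnln: "0 \<le> ln (ln (real k))" "ln (ln (real k)) \<le> ln (real k)"
    using ln_k_ge_1 ln_bound[of "ln (real k)"] by auto
  then show "ln (real k) \<le> L" "L \<le> 2 * ln (real k)" "1 \<le> L"
    using ln_k_ge_1 unfolding L_def by linarith+
  have e: "exp (1 :: real) \<ge> 5 / 2"
    using exp_lower_Taylor_quadratic[of 1] by simp
  have tangent: "ln x \<le> x / c - 1 + ln c" if "x > 0" "c > 0" for x c :: real
    using ln_le_minus_one[of "x / c"] that by (simp add: ln_div)
  have "92 \<le> (5 / 2 :: real) ^ 5"
    by (simp add: power_divide)
  also have "\<dots> \<le> exp 1 ^ 5"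
    using e by (intro power_mono) auto
  also have "\<dots> = exp 5"
    by (simp flip: exp_of_nat_mult)
  finally have "ln 92 \<le> ln (exp 5 :: real)"
    by (subst ln_le_cancel_iff) simp_all
  then have 1: "ln (real k) \<le> real k / 92 + 4"
    using tangent[of "real k" 92] k by simp
  have "5 \<le> (5 / 2 :: real) ^ 2"
    by (simp add: power_divide)
  also have "\<dots> \<le> exp 1 ^ 2"
    using e by (intro power_mono) auto
  also have "\<dots> = exp 2"
    by (simp flip: exp_of_nat_mult)
  finally have "ln 5 \<le> ln (exp 2 :: real)"
    by (subst ln_le_cancel_iff) simp_all
  then have "ln (ln (real k)) \<le> ln (real k) / 5 + 1"
    using tangent[of "ln (real k)" 5] ln_k_ge_1 by simp
  with 1 have "L \<le> 6 / 5 * (real k / 92 + 4) + 1"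
    unfolding L_def by argo
  also have "\<dots> \<le> real m / 6"
  proof -
    have "real k = 2 * real m" "real m \<ge> 46"
      using k by simp_all
    then show ?thesis
      by argo
  qed
  finally show "L \<le> real m / 6" .
qed

lemma T_ge: "T \<ge> 92" "T \<ge> real k"
proof -
  show "T \<ge> real k"
    unfolding T_def using L_bounds(3) mult_left_mono[of 1 L "real k"] by simp
  then show "T \<ge> 92"
    using k by simp
qed

lemma Y_ge: "Y \<ge> 2"
proof -
  have "2 * (2 * pi) \<le> T"
    using T_ge(1) pi_less_4 by linarith
  then show ?thesis
    unfolding Y_def by (subst pos_le_divide_eq) simp_all
qed

text \<open>This is what the choice of T achieves: L <= 2 ln k gives Y <= exp(L) / pi, hence Y^k <=
  exp(T) / pi^k. The factor exp(-2 pi Y) = exp(-T) cancels exp(T), and exp(pi) / pi^k is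
  tiny.\<close>

lemma Y_power_le: "Y ^ k * exp (- (2 * pi * (Y - 1 / 2))) \<le> 1 / 100"
proof -
  have "Y \<le> real k * ln (real k) / pi"
    using L_bounds(2) k by (simp add: Y_def T_def field_simps)
  also have "real k * ln (real k) = exp L"
    using k ln_k_ge_1 by (simp add: L_def exp_add)
  finally have "Y ^ k \<le> (exp L / pi) ^ k"
    using Y_ge by (intro power_mono) auto
  also have "\<dots> = exp T / pi ^ k"
    by (simp add: power_divide T_def flip: exp_of_nat_mult)
  finally have Yk: "Y ^ k \<le> exp T / pi ^ k" .
  have eq: "exp (- (2 * pi * (Y - 1 / 2))) = exp pi * exp (- T)"
    unfolding mult_exp_exp by (rule arg_cong[of _ _ exp]) (simp add: Y_def field_simps)
  have "Y ^ k * exp (- (2 * pi * (Y - 1 / 2))) \<le> exp T / pi ^ k * (exp pi * exp (- T))"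
    unfolding eq using Yk by (rule mult_right_mono) simp
  also have "exp T / pi ^ k * (exp pi * exp (- T)) = exp pi / pi ^ k"
    by (simp add: exp_minus)
  also have "\<dots> \<le> exp 1 ^ 4 / 3 ^ 92"
  proof (rule frac_le)
    show "exp pi \<le> exp 1 ^ 4"
      using pi_less_4 by (simp flip: exp_of_nat_mult)
    have "(3 :: real) ^ 92 \<le> 3 ^ k"
      using k by (intro power_increasing) auto
    also have "\<dots> \<le> pi ^ k"
      using pi_ge_314 by (intro power_mono) auto
    finally show "3 ^ 92 \<le> pi ^ k" .
  qed auto
  also have "\<dots> \<le> 3 ^ 4 / 3 ^ 92"
    using exp_le by (intro divide_right_mono power_mono) auto
  also have "\<dots> \<le> 1 / 100"
    by simp
  finally show ?thesis .
qed

section \<open>Contribution of the coefficients beyond T^2\<close>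

text \<open>The tangent of ln at T^2 and ln T <= 2 L bound m ln n by 2 T + n / (2 T), which is at
  most 3 n / T because n > T^2. The exponential decays like exp(-4 pi^2 n / T), with 4 pi^2 >=
  36.\<close>

lemma tail_term_bound:
  assumes "real n > T\<^sup>2"
  shows "real n ^ m * exp (- (2 * pi * (1 / Y))) ^ n \<le> exp (- (32 * T)) * exp (- (1 / T)) ^ n"
proof -
  have T: "T > 0"
    using T_ge by simp
  have n: "real n > 0"
    using assms by (meson le_less_trans zero_le_power2)
  have nT: "T \<le> real n / T"
    using assms T by (simp add: pos_le_divide_eq power2_eq_square)
  have le3: "2 * a + b / 2 \<le> 3 * b" if "a \<le> b" "0 < a" for a b :: real
    using that by simp
  have "ln T = ln (real k) + ln L"
    using k L_bounds by (simp add: T_def ln_mult)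
  also have "\<dots> \<le> L + L"
    using L_bounds(1,3) ln_bound[of L] by auto
  finally have lnT: "ln T \<le> 2 * L"
    by simp
  have "ln (real n / T\<^sup>2) \<le> real n / T\<^sup>2 - 1"
    using T n by (intro ln_le_minus_one) auto
  then have "ln (real n) \<le> 2 * ln T + real n / T\<^sup>2"
    using T n by (simp add: ln_div ln_realpow)
  also have "\<dots> \<le> 4 * L + real n / T\<^sup>2"
    using lnT by simp
  finally have "real m * ln (real n) \<le> real m * (4 * L + real n / T\<^sup>2)"
    by (rule mult_left_mono) simp
  also have "\<dots> = 2 * T + real k * (real n / T\<^sup>2) / 2"
    by (simp add: T_def k field_simps)
  also have "\<dots> \<le> 2 * T + T * (real n / T\<^sup>2) / 2"
    using T_ge(2) by (intro add_left_mono divide_right_mono mult_right_mono) auto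
  also have "T * (real n / T\<^sup>2) = real n / T"
    using T by (simp add: power2_eq_square)
  also have "2 * T + real n / T / 2 \<le> 3 * (real n / T)"
    using nT T by (rule le3)
  finally have "exp (real m * ln (real n)) \<le> exp (3 * (real n / T))"
    by (simp only: exp_le_cancel_iff)
  then have "real n ^ m \<le> exp (3 * (real n / T))"
    unfolding exp_of_nat_mult exp_ln[OF n] .
  moreover have "exp (- (2 * pi * (1 / Y))) ^ n = exp (- (4 * pi\<^sup>2 * (real n / T)))"
    by (simp add: Y_def power2_eq_square field_simps flip: exp_of_nat_mult)
  moreover have "\<dots> \<le> exp (- (36 * (real n / T)))"
  proof -
    have "3\<^sup>2 \<le> pi\<^sup>2"
      using pi_ge_314 by (intro power_mono) auto
    then have "36 * (real n / T) \<le> 4 * pi\<^sup>2 * (real n / T)"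
      using T n by (intro mult_right_mono) auto
    then show ?thesis
      by simp
  qed
  ultimately have "real n ^ m * exp (- (2 * pi * (1 / Y))) ^ n \<le> exp (3 * (real n / T)) * exp (- (36 * (real n / T)))"
    by (intro mult_mono) auto
  \<comment> \<open>Of the surplus 33 n / T, the part 32 n / T is at least 32 T; the remaining n / T
    keeps geometric decay in n.\<close>
  also have "\<dots> \<le> exp (- (32 * T) + - (real n / T))"
    unfolding mult_exp_exp using nT by simp
  also have "\<dots> = exp (- (32 * T)) * exp (- (1 / T)) ^ n"
    unfolding exp_add by (simp flip: exp_of_nat_mult)
  finally show ?thesis .
qed

text \<open>The sum is 1 / (exp(1/T) - 1), and exp(1/T) >= 1 + 1/T.\<close>

lemma tail_geometric:
  shows "summable (\<lambda>n. exp (- (1 / T)) ^ Suc n)"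
    and "(\<Sum>n. exp (- (1 / T)) ^ Suc n) \<le> T"
proof -
  let ?x = "exp (- (1 / T))"
  have T: "T > 0"
    using T_ge by simp
  have x: "norm ?x < 1"
    using T by simp
  then have "summable (\<lambda>n. ?x ^ n)"
    by (rule summable_geometric)
  then show summable: "summable (\<lambda>n. ?x ^ Suc n)"
    by (subst summable_Suc_iff)
  have "1 + 1 / T \<le> exp (1 / T)"
    by (rule exp_ge_add_one_self)
  then have "?x * (1 + 1 / T) \<le> 1"
    by (simp add: exp_minus field_simps)
  then have "?x / (1 - ?x) \<le> T"
    using x T by (simp add: field_simps)
  moreover have "(\<Sum>n. ?x ^ Suc n) = ?x / (1 - ?x)"
    using suminf_mult[OF \<open>summable (\<lambda>n. ?x ^ n)\<close>, of ?x] suminf_geometric[OF x]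
    by simp
  ultimately show "(\<Sum>n. ?x ^ Suc n) \<le> T"
    by simp
qed

lemma tail_constant: "exp pi * exp (- (32 * T)) * T \<le> 1 / 200"
proof -
  have T: "T \<ge> 92"
    by (rule T_ge)
  have T_le: "T \<le> exp T"
    using exp_ge_add_one_self[of T] by linarith
  have "exp pi * exp (- (32 * T)) * T \<le> exp T * exp (- (32 * T)) * exp T"
    using T pi_less_4 T_le by (intro mult_mono) auto
  also have "\<dots> = exp (- (30 * T))"
    by (simp add: mult_exp_exp)
  also have "\<dots> \<le> 1 / (1 + 30 * T)"
    using exp_ge_add_one_self[of "30 * T"] T by (simp add: exp_minus field_simps)
  also have "\<dots> \<le> 1 / 200"
    using T by (simp add: field_simps)
  finally show ?thesis .
qed

text \<open>The Hecke bound is set against the Eisenstein lower bound. After division by n^m the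
  right side still grows like n^(m-1), so the threshold Q decides. There U = k^2 L links all
  quantities: 2 pi k Y = U and 7316 Q = U^2.\<close>

lemma final_inequality:
  assumes n: "real n \<ge> real k ^ 4 * L\<^sup>2 / 7316"
  shows "exp pi * (3 * Y ^ k) * real n ^ m < 3 / 5 * ((2 * pi) ^ k / fact (k - 1)) * real n ^ (k - 1)"
proof -
  define Q where "Q = real k ^ 4 * L\<^sup>2 / 7316"
  define F where "F = (fact (k - 1) :: real)"
  define U where "U = (real k)\<^sup>2 * L"
  have Q: "Q > 0"
    using k L_bounds(3) by (simp add: Q_def)
  have U: "U > 0"
    using k L_bounds(3) by (simp add: U_def)
  have "Q * 7316 = U\<^sup>2"
    by (simp add: Q_def U_def power_mult_distrib flip: power_mult)
  then have QU: "Q ^ m * 7316 ^ m = U ^ k"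
    by (simp add: k power_mult flip: power_mult_distrib)
  \<comment> \<open>The constant 7316 matters only here: the surplus \<open>(25/16)\<^sup>m\<close> absorbs the polynomial factor \<open>Q\<close>.\<close>
  have "7316 * (25 / 16) \<le> (4 * pi\<^sup>2 * exp 1)\<^sup>2"
  proof -
    have "(157 / 50)\<^sup>2 \<le> pi\<^sup>2"
      using pi_ge_314 by (intro power_mono) auto
    then have "4 * (157 / 50)\<^sup>2 * (2716 / 1000) \<le> 4 * pi\<^sup>2 * exp 1"
      using exp_1_ge by (intro mult_mono) auto
    then have "(4 * (157 / 50)\<^sup>2 * (2716 / 1000))\<^sup>2 \<le> (4 * pi\<^sup>2 * exp 1)\<^sup>2"
      by (intro power_mono) auto
    then show ?thesis
      by (simp add: power2_eq_square)
  qed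
  then have "(7316 * (25 / 16)) ^ m \<le> ((4 * pi\<^sup>2 * exp 1)\<^sup>2) ^ m"
    by (intro power_mono) auto
  then have base: "7316 ^ m * (25 / 16) ^ m \<le> (4 * pi\<^sup>2 * exp 1) ^ k"
    by (simp only: k power_mult power_mult_distrib)
  have exponential: "5 * exp pi * exp 1 * Q < (25 / 16) ^ m"
  proof -
    have "exp pi * exp 1 \<le> exp 1 ^ 5"
      using pi_less_4 by (simp add: mult_exp_exp flip: exp_of_nat_mult)
    also have "\<dots> \<le> 3 ^ 5"
      using exp_le by (intro power_mono) auto
    finally have le: "exp pi * exp 1 \<le> 3 ^ 5" .
    have "5 * (exp pi * exp 1) * Q \<le> 5 * 3 ^ 5 * Q"
      using Q by (intro mult_right_mono mult_left_mono le) simp_all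
    also have "Q \<le> real k ^ 4 * (real m / 6)\<^sup>2 / 7316"
      unfolding Q_def using L_bounds(3,4) by (intro divide_right_mono mult_left_mono power_mono) auto
    then have "5 * 3 ^ 5 * Q \<le> 5 * 3 ^ 5 * (real k ^ 4 * (real m / 6)\<^sup>2 / 7316)"
      by simp
    also have "\<dots> \<le> 2 / 25 * real m ^ 6"
      by (simp add: k power_mult_distrib power_divide flip: power_add)
    \<comment> \<open>The induction starts at m = 46, where the inequality holds with little room;
      the step needs only (47/46)^6 <= 25/16.\<close>
    also have "\<dots> < (25 / 16) ^ m"
      using k(2)
    proof (induction m rule: dec_induct)
      case (step j)
      have "real (Suc j) \<le> 47 / 46 * real j"
        using step(1) by simp
      then have "real (Suc j) ^ 6 \<le> (47 / 46 * real j) ^ 6"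
        by (intro power_mono) auto
      also have "\<dots> \<le> 25 / 16 * real j ^ 6"
        unfolding power_mult_distrib by (intro mult_right_mono) (simp_all add: power_divide)
      finally show ?case
        using step(3) by simp
    qed (simp add: power_divide)
    finally show ?thesis
      by (simp add: mult_ac)
  qed
  have F: "F * exp (real k) \<le> exp 1 * real k ^ k"
    unfolding F_def using k by (intro fact_le_exp) simp
  \<comment> \<open>An auxiliary factor, cancelled at the end: exp k prepares the Stirling bound, (2
    pi)^k completes Y to U / k, and Q raises Q^(m-1) to Q^m.\<close>
  define P where "P = exp (real k) * (2 * pi) ^ k * Q"
  have P: "P > 0"
    using Q by (simp add: P_def)
  have "5 * exp pi * Y ^ k * F * P = 5 * exp pi * Y ^ k * (2 * pi) ^ k * Q * (F * exp (real k))"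
    by (simp add: P_def mult_ac)
  also have "\<dots> \<le> 5 * exp pi * Y ^ k * (2 * pi) ^ k * Q * (exp 1 * real k ^ k)"
    using F Q Y_ge by (intro mult_left_mono) auto
  also have "\<dots> = 5 * exp pi * exp 1 * Q * (Y * (2 * pi) * real k) ^ k"
    by (simp only: power_mult_distrib mult_ac)
  also have "Y * (2 * pi) * real k = U"
    by (simp add: Y_def T_def U_def power2_eq_square)
  also have "5 * exp pi * exp 1 * Q * U ^ k < (25 / 16) ^ m * U ^ k"
    using exponential U by (intro mult_strict_right_mono) auto
  also have "\<dots> = Q ^ m * (7316 ^ m * (25 / 16) ^ m)"
    by (simp add: mult_ac flip: QU)
  also have "\<dots> \<le> Q ^ m * (4 * pi\<^sup>2 * exp 1) ^ k"
    using base Q by (intro mult_left_mono) auto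
  also have "Q ^ m = Q ^ (m - 1) * Q"
    using k by (simp flip: power_Suc2)
  also have "(4 * pi\<^sup>2 * exp 1) ^ k = ((2 * pi) * (2 * pi) * exp 1) ^ k"
    by (simp add: power2_eq_square)
  also have "Q ^ (m - 1) * Q * ((2 * pi) * (2 * pi) * exp 1) ^ k = (2 * pi) ^ k * Q ^ (m - 1) * P"
    unfolding P_def power_mult_distrib[of _ "exp 1"] power_mult_distrib[of "2 * pi" "2 * pi"]
      exp_of_nat_mult[of k 1, simplified]
    by (simp only: mult_ac)
  finally have "5 * exp pi * Y ^ k * F < (2 * pi) ^ k * Q ^ (m - 1)"
    using P by (simp only: mult_less_cancel_right_pos)
  also have "\<dots> \<le> (2 * pi) ^ k * real n ^ (m - 1)"
    using n Q by (intro mult_left_mono power_mono) (auto simp: Q_def)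
  finally have "5 * exp pi * Y ^ k * F * (3 / 5 * real n ^ m / F)
      < (2 * pi) ^ k * real n ^ (m - 1) * (3 / 5 * real n ^ m / F)"
    using n Q by (intro mult_strict_right_mono) (auto simp: F_def Q_def)
  moreover have "k - 1 = (m - 1) + m"
    using k by simp
  ultimately show ?thesis
    by (simp add: F_def power_add mult_ac)
qed

section \<open>Bounding the absolute series by inversion\<close>

text \<open>Common to f and the Eisenstein series. The last hypothesis says that the coefficients
  are nonnegative up to a geometric defect of total at most K T, so the value at i/Y controls the
  absolute series. Inversion moves this value to iY, where all but the constant term is damped by
  \<open>Y_power_le\<close>.\<close>

lemma abs_series_bound:
  assumes f: "q_expansion f a" "a 0 = 1"
    and S: "\<And>z. z \<in> upper_half_plane \<Longrightarrow> f (- 1 / z) = z ^ k * f z"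
    and k4: "4 dvd k"
    and K: "K \<ge> 0"
    and a: "\<And>n. n \<ge> 1 \<Longrightarrow> norm (a n) * exp (- (2 * pi * (1 / Y))) ^ n
      \<le> Re (a n) * exp (- (2 * pi * (1 / Y))) ^ n + K * exp (- (1 / T)) ^ n"
  shows "abs_series a (1 / 2) \<le> Y ^ k - 1 + abs_series a (1 / 2) / 100 + K * T"
proof -
  define x where "x = exp (- (2 * pi * (1 / Y)))"
  have Y: "Y > 0" "1 / 2 \<le> Y" "0 < 1 / Y" "1 / Y \<le> 1 / 2"
    using Y_ge by (simp_all add: field_simps)
  have half: "abs_series a (1 / 2) \<ge> 0"
    by (rule abs_series_nonneg[OF f(1)]) simp
  have "abs_series a (1 / 2) \<le> exp (- (2 * pi * (1 / 2 - 1 / Y))) * abs_series a (1 / Y)"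
    using abs_series_mono[OF f(1) Y(3,4)] .
  also have "\<dots> \<le> 1 * abs_series a (1 / Y)"
    using Y abs_series_nonneg[OF f(1) Y(3)] by (intro mult_right_mono) auto
  finally have mono: "abs_series a (1 / 2) \<le> abs_series a (1 / Y)"
    by simp
  have z: "\<i> / of_real Y \<in> upper_half_plane" "\<i> * of_real Y \<in> upper_half_plane"
    using Y by (simp_all add: upper_half_plane_def)
  have "nome (\<i> / of_real Y) = of_real x"
    unfolding x_def exp_of_real[symmetric] by (rule arg_cong[of _ _ exp]) (simp add: field_simps)
  then have "(\<lambda>n. a n * of_real x ^ n) sums f (\<i> / of_real Y)"
    using f(1) z(1) unfolding q_expansion_iff by metis
  then have "(\<lambda>n. a (Suc n) * of_real x ^ Suc n) sums (f (\<i> / of_real Y) - 1)"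
    using f(2) by (subst sums_Suc_iff) simp
  from sums_Re[OF this]
  have Re_sums: "(\<lambda>n. Re (a (Suc n)) * x ^ Suc n) sums (Re (f (\<i> / of_real Y)) - 1)"
    by (simp flip: of_real_power of_real_mult)
  have s2: "(\<lambda>n. Re (a (Suc n)) * x ^ Suc n + K * exp (- (1 / T)) ^ Suc n)
      sums (Re (f (\<i> / of_real Y)) - 1 + K * (\<Sum>n. exp (- (1 / T)) ^ Suc n))"
    by (intro sums_add Re_sums sums_mult summable_sums tail_geometric)
  have s1: "(\<lambda>n. norm (a (Suc n)) * x ^ Suc n) sums abs_series a (1 / Y)"
    unfolding abs_series_def x_def by (intro summable_sums summable_abs_series_Suc[OF f(1) Y(3)])
  have le: "norm (a (Suc n)) * x ^ Suc n \<le> Re (a (Suc n)) * x ^ Suc n + K * exp (- (1 / T)) ^ Suc n" for n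
    unfolding x_def by (rule a) simp
  have "abs_series a (1 / Y) \<le> Re (f (\<i> / of_real Y)) - 1 + K * (\<Sum>n. exp (- (1 / T)) ^ Suc n)"
    by (rule sums_le[OF le s1 s2])
  also have "\<dots> \<le> Re (f (\<i> / of_real Y)) - 1 + K * T"
    using tail_geometric(2) K by (intro add_left_mono mult_left_mono)
  also have "Re (f (\<i> / of_real Y)) \<le> Y ^ k + abs_series a (1 / 2) / 100"
  proof -
    have "- 1 / (\<i> * of_real Y) = \<i> / of_real Y"
      by (simp add: divide_inverse)
    moreover have "\<i> ^ k = 1"
      using k4 by (auto simp: power_mult power4_eq_xxxx elim!: dvdE)
    ultimately have fY: "f (\<i> / of_real Y) = of_real (Y ^ k) * f (\<i> * of_real Y)"
      using S[OF z(2)] by (simp add: power_mult_distrib)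
    have "norm (f (\<i> * of_real Y) - 1) \<le> abs_series a Y"
      using norm_minus_const_le[OF f(1) z(2)] f(2) by simp
    also have "\<dots> \<le> exp (- (2 * pi * (Y - 1 / 2))) * abs_series a (1 / 2)"
      by (rule abs_series_mono[OF f(1)]) (use Y in auto)
    finally have "Re (f (\<i> * of_real Y)) \<le> 1 + exp (- (2 * pi * (Y - 1 / 2))) * abs_series a (1 / 2)"
      using complex_Re_le_cmod[of "f (\<i> * of_real Y) - 1"] by simp
    then have "Re (f (\<i> / of_real Y)) \<le> Y ^ k * (1 + exp (- (2 * pi * (Y - 1 / 2))) * abs_series a (1 / 2))"
      using Y unfolding fY by (simp add: mult_left_mono del: of_real_power)
    also have "\<dots> = Y ^ k + (Y ^ k * exp (- (2 * pi * (Y - 1 / 2)))) * abs_series a (1 / 2)"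
      by (simp add: ring_distribs)
    also have "\<dots> \<le> Y ^ k + 1 / 100 * abs_series a (1 / 2)"
      using Y_power_le half by (intro add_left_mono mult_right_mono)
    finally show ?thesis
      by simp
  qed
  finally show ?thesis
    using mono by simp
qed

text \<open>A cusp form whose coefficients vanish up to \<open>T\<^sup>2\<close> is zero: the coefficient bound
  applied to the tail would make \<open>abs_series\<close> smaller than itself.\<close>

lemma cusp_form_eq_0:
  assumes g: "q_expansion g b" and b: "\<And>n. real n \<le> T\<^sup>2 \<Longrightarrow> b n = 0"
    and S: "\<And>z. z \<in> upper_half_plane \<Longrightarrow> g (- 1 / z) = z ^ k * g z"
  shows "b n = 0"
proof -
  define G where "G = abs_series b (1 / 2)"
  define K where "K = exp pi * G * exp (- (32 * T))"
  have bound: "norm (b n) \<le> exp pi * G * real n ^ m" for n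
    unfolding G_def using cusp_coefficient_bound[OF g b _ _ S, of n] k T_ge(1) by simp
  have G: "G \<ge> 0"
    unfolding G_def by (rule abs_series_nonneg[OF g]) simp
  have le: "norm (b n) * exp (- (2 * pi * (1 / 2))) ^ n \<le> K * exp (- (1 / T)) ^ n" for n
  proof (cases "real n \<le> T\<^sup>2")
    case True
    then show ?thesis
      using b G by (simp add: K_def)
  next
    case False
    \<comment> \<open>\<open>tail_term_bound\<close> speaks of height 1/Y, where the terms are at
      least as large as at height 1/2.\<close>
    have "1 / Y \<le> 1 / 2"
      using Y_ge by (simp add: field_simps)
    then have "2 * pi * (1 / Y) \<le> 2 * pi * (1 / 2)"
      by (rule mult_left_mono) simp
    then have "exp (- (2 * pi * (1 / 2))) ^ n \<le> exp (- (2 * pi * (1 / Y))) ^ n"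
      by (intro power_mono) simp_all
    with bound[of n] have "norm (b n) * exp (- (2 * pi * (1 / 2))) ^ n
        \<le> (exp pi * G * real n ^ m) * exp (- (2 * pi * (1 / Y))) ^ n"
      using G by (intro mult_mono) auto
    also have "\<dots> = exp pi * G * (real n ^ m * exp (- (2 * pi * (1 / Y))) ^ n)"
      by (simp only: mult.assoc)
    also have "\<dots> \<le> exp pi * G * (exp (- (32 * T)) * exp (- (1 / T)) ^ n)"
      using tail_term_bound[of n] False G by (intro mult_left_mono) auto
    finally show ?thesis
      by (simp only: K_def mult.assoc)
  qed
  have "G \<le> (\<Sum>n. K * exp (- (1 / T)) ^ Suc n)"
    unfolding G_def abs_series_def
    by (intro suminf_le le summable_mult tail_geometric summable_abs_series_Suc[OF g]) simp
  also have "\<dots> = K * (\<Sum>n. exp (- (1 / T)) ^ Suc n)"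
    by (rule suminf_mult) (rule tail_geometric)
  also have "\<dots> \<le> K * T"
    using tail_geometric(2) G by (intro mult_left_mono) (simp_all add: K_def)
  also have "K * T = G * (exp pi * exp (- (32 * T)) * T)"
    by (simp add: K_def mult_ac)
  also have "\<dots> \<le> G * (1 / 200)"
    using tail_constant G by (rule mult_left_mono)
  finally have "G = 0"
    using G by simp
  then show ?thesis
    using bound[of n] by simp
qed

end

section \<open>Positivity of the coefficients\<close>

theorem theorem9:
  fixes k :: nat and f :: "complex \<Rightarrow> complex" and a :: "nat \<Rightarrow> complex"
  assumes "k \<ge> 92" and "k mod 4 = 0"
    and "modular_form k f" and "q_expansion f a" and "a 0 = 1"
    and "\<forall>n::nat. 1 \<le> n \<and> real n \<le> real k ^ 2 * (ln (real k) + ln (ln (real k))) ^ 2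
              \<longrightarrow> a n \<ge> 0"
  shows "\<forall>n::nat. real n \<ge> real k ^ 4 * (ln (real k) + ln (ln (real k))) ^ 2 / 7316
              \<longrightarrow> a n > 0"
proof -
  define m where "m = k div 2"
  define L where "L = ln (real k) + ln (ln (real k))"
  define T where "T = real k * L"
  define Y where "Y = T / (2 * pi)"
  have weight: "k = 2 * m" "m \<ge> 46" "4 dvd k" "even k" "k > 0"
    using assms(1,2) by (auto simp: m_def)
  interpret large_weight k m L T Y
    by unfold_locales (use weight in \<open>simp_all add: L_def T_def Y_def\<close>)
  have f: "f (- 1 / z) = z ^ k * f z" if "z \<in> upper_half_plane" for z
    using assms(3) that by (auto simp: modular_form_def)
  have nonneg: "a n \<ge> 0" if "real n \<le> T\<^sup>2" for n
    using assms(5,6) that by (cases "n = 0") (auto simp: T_def L_def power_mult_distrib less_eq_complex_def)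
  \<comment> \<open>The difference of f and its reflection has coefficients 2 i Im a(n). They vanish
    up to T^2, since \<open>nonneg\<close> includes reality in the complex order, hence they vanish
    for all n by \<open>cusp_form_eq_0\<close>.\<close>
  have real: "Im (a n) = 0" for n
  proof -
    define g where "g = (\<lambda>z. f z - cnj (f (- cnj z)))"
    have g_S: "g (- 1 / z) = z ^ k * g z" if z: "z \<in> upper_half_plane" for z
    proof -
      have "- cnj z \<in> upper_half_plane"
        using z by (simp add: upper_half_plane_def)
      from f[OF this] have "f (1 / cnj z) = cnj z ^ k * f (- cnj z)"
        using weight(4) by simp
      then have "cnj (f (- cnj (- 1 / z))) = z ^ k * cnj (f (- cnj z))"
        by simp
      then show ?thesis
        using f[OF z] by (simp add: g_def right_diff_distrib)
    qed
    have g: "q_expansion g (\<lambda>n. a n - cnj (a n))"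
      unfolding g_def by (intro q_expansion_diff q_expansion_cnj assms(4))
    have "a n - cnj (a n) = 0" if "real n \<le> T\<^sup>2" for n
      using nonneg[OF that] by (simp add: complex_eq_iff less_eq_complex_def)
    from cusp_form_eq_0[OF g this g_S] have "a n - cnj (a n) = 0" .
    then show ?thesis
      by (simp add: complex_eq_iff)
  qed
  obtain E e where E: "q_expansion E (\<lambda>n. of_real (e n))"
    and E_S: "\<And>z. z \<in> upper_half_plane \<Longrightarrow> E (- 1 / z) = z ^ k * E z"
    and e_0: "e 0 = 1"
    and e: "\<And>n. n \<ge> 1 \<Longrightarrow> e n \<ge> 3 / 5 * ((2 * pi) ^ k / fact (k - 1)) * real n ^ (k - 1)"
    by (rule eisenstein_series_exists[OF assms(2)]) (use assms(1) in \<open>simp, blast\<close>)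
  have e_nonneg: "e n \<ge> 0" for n
  proof (cases "n = 0")
    case False
    have "0 \<le> 3 / 5 * ((2 * pi) ^ k / fact (k - 1)) * real n ^ (k - 1)"
      by simp
    also have "\<dots> \<le> e n"
      using e False by simp
    finally show ?thesis .
  qed (simp add: e_0)
  define b where "b = (\<lambda>n. a n - of_real (e n))"
  define g where "g = (\<lambda>z. f z - E z)"
  have g: "q_expansion g b"
    unfolding g_def b_def by (intro q_expansion_diff assms(4) E)
  have g_S: "g (- 1 / z) = z ^ k * g z" if "z \<in> upper_half_plane" for z
    using f[OF that] E_S[OF that] by (simp add: g_def right_diff_distrib)
  define PE where "PE = abs_series (\<lambda>n. of_real (e n)) (1 / 2)"
  define P where "P = abs_series a (1 / 2)"
  define G where "G = abs_series b (1 / 2)"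
  have G: "G \<ge> 0"
    unfolding G_def by (rule abs_series_nonneg[OF g]) simp
  have bound: "norm (b n) \<le> exp pi * G * real n ^ m" for n
    unfolding G_def using cusp_coefficient_bound[OF g _ weight(4,5) g_S, of n] weight(1) assms(5) e_0
    by (simp add: b_def)
  \<comment> \<open>All e(n) are nonnegative, so the defect constant is 0 here.\<close>
  have "PE \<le> Y ^ k - 1 + PE / 100 + 0 * T"
    unfolding PE_def using e_nonneg e_0 weight(3)
    by (intro abs_series_bound[OF E _ E_S]) auto
  \<comment> \<open>The factor 2 arises because |a(n)| - Re a(n) = 2 |a(n)| for negative
    a(n).\<close>
  moreover define K where "K = 2 * (exp pi * G * exp (- (32 * T)))"
  have "P \<le> Y ^ k - 1 + P / 100 + K * T"
    unfolding P_def
  proof (rule abs_series_bound[OF assms(4,5) f weight(3)])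
    show "K \<ge> 0"
      using G by (simp add: K_def)
    fix n :: nat assume n: "n \<ge> 1"
    define x where "x = exp (- (2 * pi * (1 / Y)))"
    show "norm (a n) * x ^ n \<le> Re (a n) * x ^ n + K * exp (- (1 / T)) ^ n"
    proof (cases "Re (a n) \<ge> 0")
      case True
      then have "norm (a n) = Re (a n)"
        using real[of n] by (simp add: cmod_eq_Re)
      then show ?thesis
        using \<open>K \<ge> 0\<close> by simp
    next
      case False
      then have "real n > T\<^sup>2"
        using nonneg[of n] by (force simp: less_eq_complex_def)
      have "norm (a n) = - Re (a n)"
        using real[of n] False by (simp add: cmod_eq_Re)
      \<comment> \<open>Re a(n) = e(n) + Re b(n) with e(n) >= 0, so a negative a(n) must be
        outweighed by b(n).\<close>
      also have "\<dots> \<le> norm (b n)"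
        using abs_Re_le_cmod[of "b n"] e_nonneg[of n] by (simp add: b_def)
      finally have "norm (a n) - Re (a n) \<le> 2 * (exp pi * G * real n ^ m)"
        using \<open>norm (a n) = - Re (a n)\<close> bound[of n] by linarith
      then have "(norm (a n) - Re (a n)) * x ^ n \<le> 2 * (exp pi * G * real n ^ m) * x ^ n"
        by (rule mult_right_mono) (simp add: x_def)
      also have "\<dots> = 2 * (exp pi * G) * (real n ^ m * x ^ n)"
        by (simp only: mult.assoc)
      also have "\<dots> \<le> 2 * (exp pi * G) * (exp (- (32 * T)) * exp (- (1 / T)) ^ n)"
        using tail_term_bound[OF \<open>real n > T\<^sup>2\<close>] G unfolding x_def by (intro mult_left_mono) auto
      also have "\<dots> = K * exp (- (1 / T)) ^ n"
        by (simp only: K_def mult.assoc)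
      finally show ?thesis
        by (simp add: left_diff_distrib)
    qed
  qed
  moreover have "K * T \<le> G / 100"
    using mult_left_mono[OF tail_constant G] by (simp add: K_def mult_ac)
  moreover have "G \<le> P + PE"
  proof -
    let ?x = "exp (- (2 * pi * (1 / 2)))"
    have "(\<Sum>n. norm (b (Suc n)) * ?x ^ Suc n)
        \<le> (\<Sum>n. norm (a (Suc n)) * ?x ^ Suc n + norm (complex_of_real (e (Suc n))) * ?x ^ Suc n)"
    proof (intro suminf_le summable_add summable_abs_series_Suc[OF g] summable_abs_series_Suc[OF E]
        summable_abs_series_Suc[OF assms(4)])
      fix n
      have "norm (b (Suc n)) \<le> norm (a (Suc n)) + norm (complex_of_real (e (Suc n)))"
        unfolding b_def by (rule norm_triangle_ineq4)
      then have "norm (b (Suc n)) * ?x ^ Suc n \<le> (norm (a (Suc n)) + norm (complex_of_real (e (Suc n)))) * ?x ^ Suc n"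
        by (rule mult_right_mono) simp
      then show "norm (b (Suc n)) * ?x ^ Suc n
          \<le> norm (a (Suc n)) * ?x ^ Suc n + norm (complex_of_real (e (Suc n))) * ?x ^ Suc n"
        by (simp only: distrib_right)
    qed simp_all
    also have "\<dots> = P + PE"
      unfolding P_def PE_def abs_series_def
      by (intro suminf_add[symmetric] summable_abs_series_Suc[OF E] summable_abs_series_Suc[OF assms(4)]) simp_all
    finally show ?thesis
      by (simp only: G_def abs_series_def)
  qed
  \<comment> \<open>Adding the bounds for P and PE gives 0.99 G <= 2 (Y^k - 1) + G / 100, so the
    constant 3 is generous.\<close>
  ultimately have "G \<le> 3 * Y ^ k"
    using Y_ge zero_le_power[of Y k] by linarith
  show ?thesis
  proof (intro allI impI)
    fix n :: nat assume n: "real n \<ge> real k ^ 4 * (ln (real k) + ln (ln (real k))) ^ 2 / 7316"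
    have "real k ^ 4 * L\<^sup>2 / 7316 > 0"
      using weight(5) L_bounds(3) by simp
    with n have "n \<ge> 1"
      unfolding L_def by (cases n) auto
    have "norm (b n) \<le> exp pi * (3 * Y ^ k) * real n ^ m"
      using bound[of n] \<open>G \<le> 3 * Y ^ k\<close>
      by (elim order_trans) (intro mult_right_mono mult_left_mono; simp)
    also have "\<dots> < 3 / 5 * ((2 * pi) ^ k / fact (k - 1)) * real n ^ (k - 1)"
      using final_inequality[of n] n by (simp add: L_def)
    also have "\<dots> \<le> e n"
      by (rule e[OF \<open>n \<ge> 1\<close>])
    finally have "norm (b n) < e n" .
    then have "Re (a n) > 0"
      using abs_Re_le_cmod[of "b n"] by (simp add: b_def)
    then show "a n > 0"
      using real[of n] by (simp add: less_complex_def)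
  qed
qed

end
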